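(* Let $G=([n],E)$ be a chordal graph whose vertex ordering $1,2,\ldots,n$ is a perfect elimination ordering. Run Algorithm R on $G$ with initial elimination forest $F_0$, where $F_0$ is the elimination forest obtained by removing the vertices in the order $1,2,\ldots,n$. Then Algorithm R visits every elimination forest for $G$ exactly once.
   Context: For a graph $G$ and a vertex set $X$, $G-X$ is the graph obtained by deleting $X$. An elimination tree for a connected graph $G=(V,E)$ is a rooted tree on vertex set $V$ consisting of a root $x\in V$ whose children are the roots of elimination trees for the connected components of $G-x$ (children are unordered). An elimination forest for $G$ is a set of elimination trees, one for each connected component of $G$; $\mathcal{E}(G)$ is the set of all elimination forests. Removing vertices in an order (an elimination ordering) determines an elimination forest: the first removed vertex of a component is the root of its tree, and one recurses on the components that remain. A perfect elimination ordering of $G=([n],E)$ is the ordering $1,\ldots,n$ such that every vertex $v$ forms a clique together with its neighbors smaller than $v$. Rotation: let $T$ be an elimination tree in an elimination forest, $j$ a non-root vertex of $T$ with parent $i$, and $H$ the subgraph of $G$ induced by the vertices of the subtree of $T$ rooted at $i$. Rotating the edge $\{i,j\}$ yields the tree $T'$ in which $j$ takes the place of $i$ (it becomes the child of the former parent of $i$, or the root if $i$ was the root), $i$ becomes a child of $j$, all subtrees of $i$ remain subtrees of $i$, and each subtree $S$ of $j$ remains a subtree of $j$ unless the vertices of $S$ lie in the same connected component of $H-j$ as $i$, in which case $S$ becomes a subtree of $i$. A rotation in a forest is a rotation in one of its trees. For a vertex $j$, an up-rotation of $j$ is the rotation of the edge between $j$ and its parent $i$ when $i<j$; a down-rotation of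 $j$ is the rotation of an edge between $j$ and a child $i$ of $j$ with $i<j$. Algorithm R (input: graph $G=([n],E)$ and initial forest $F_0\in\mathcal{E}(G)$): visit $F_0$. Then repeat: in the most recently visited forest $F$, let $j$ be the largest vertex such that some up- or down-rotation of $j$ produces a forest that has not been visited yet. If no such $j$ exists, terminate. If there is more than one edge $\{i,j\}$ with $i<j$ whose rotation produces an unvisited forest, terminate. Otherwise, perform that rotation, visit the resulting forest, and repeat. *)

theory Defs
  imports Main "HOL-Library.FSet"
begin

section \<open>Graphs\<close>

text \<open>A simple graph on the vertex set \<open>{1..n}\<close> is given by its symmetric, irreflexive
  adjacency relation \<open>E\<close>; the subgraph induced by a vertex set \<open>X\<close> is given by \<open>X\<close> and
  \<open>Restr E X\<close>.\<close>

definition simple_graph :: "nat \<Rightarrow> nat rel \<Rightarrow> bool" where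
  "simple_graph n E \<longleftrightarrow> E \<subseteq> {1..n} \<times> {1..n} \<and> sym E \<and> irrefl E"

definition connected_on :: "nat rel \<Rightarrow> nat set \<Rightarrow> bool" where
  "connected_on E X \<longleftrightarrow> X \<noteq> {} \<and> (\<forall>u\<in>X. \<forall>v\<in>X. (u, v) \<in> (Restr E X)\<^sup>*)"

definition components :: "nat rel \<Rightarrow> nat set \<Rightarrow> nat set set" where
  "components E X = {{v \<in> X. (u, v) \<in> (Restr E X)\<^sup>*} | u. u \<in> X}"

definition is_cycle :: "nat rel \<Rightarrow> nat list \<Rightarrow> bool" where
  "is_cycle E c \<longleftrightarrow> length c \<ge> 3 \<and> distinct c \<and>
     (\<forall>i<length c. (c ! i, c ! (Suc i mod length c)) \<in> E)"

definition has_chord :: "nat rel \<Rightarrow> nat list \<Rightarrow> bool" where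
  "has_chord E c \<longleftrightarrow> (\<exists>i<length c. \<exists>j<length c. (c ! i, c ! j) \<in> E \<and>
     j \<noteq> Suc i mod length c \<and> i \<noteq> Suc j mod length c)"

definition chordal :: "nat rel \<Rightarrow> bool" where
  "chordal E \<longleftrightarrow> (\<forall>c. is_cycle E c \<and> length c \<ge> 4 \<longrightarrow> has_chord E c)"

definition clique :: "nat rel \<Rightarrow> nat set \<Rightarrow> bool" where
  "clique E X \<longleftrightarrow> (\<forall>u\<in>X. \<forall>v\<in>X. u \<noteq> v \<longrightarrow> (u, v) \<in> E)"

definition perfect_elimination_ordering :: "nat \<Rightarrow> nat rel \<Rightarrow> bool" where
  "perfect_elimination_ordering n E \<longleftrightarrow>
     (\<forall>v\<in>{1..n}. clique E (insert v {u. (u, v) \<in> E \<and> u < v}))"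

section \<open>Elimination trees and forests\<close>

text \<open>Rooted trees with unordered children; \<open>verts\<close> is the set of vertices of a tree.\<close>

datatype (verts: 'a) rtree = Node 'a "'a rtree fset"

type_synonym forest = "nat rtree set"

text \<open>\<open>elim_tree E K T\<close>: \<open>T\<close> is an elimination tree for the connected subgraph induced by \<open>K\<close>.
  The function \<open>f\<close> picks one elimination tree for each component of what remains after
  the root is deleted.\<close>

inductive elim_tree :: "nat rel \<Rightarrow> nat set \<Rightarrow> nat rtree \<Rightarrow> bool" for E :: "nat rel" where
  elim_node: "connected_on E K \<Longrightarrow> x \<in> K \<Longrightarrow>
     \<forall>L \<in> components E (K - {x}). elim_tree E L (f L) \<Longrightarrow>
     fset C = f ` components E (K - {x}) \<Longrightarrow>
     elim_tree E K (Node x C)"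

definition elim_forests :: "nat rel \<Rightarrow> nat set \<Rightarrow> forest set" where
  "elim_forests E V =
     {F. \<exists>f. (\<forall>K \<in> components E V. elim_tree E K (f K)) \<and> F = f ` components E V}"

text \<open>\<open>ordering_tree E xs K\<close> is the elimination tree of the connected vertex set \<open>K\<close> obtained by
  removing vertices in the order \<open>xs\<close>. The empty ordering is reached only if \<open>xs\<close> does not
  enumerate all of \<open>K\<close>.\<close>

primrec ordering_tree :: "nat rel \<Rightarrow> nat list \<Rightarrow> nat set \<Rightarrow> nat rtree" where
  "ordering_tree E [] = (\<lambda>K. undefined)"
| "ordering_tree E (x # xs) = (\<lambda>K.
     if x \<in> K then Node x (Abs_fset (ordering_tree E xs ` components E (K - {x})))
     else ordering_tree E xs K)"

definition ordering_forest :: "nat rel \<Rightarrow> nat list \<Rightarrow> nat set \<Rightarrow> forest" where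
  "ordering_forest E xs V = ordering_tree E xs ` components E V"

section \<open>Rotations\<close>

definition same_component :: "nat rel \<Rightarrow> nat set \<Rightarrow> nat \<Rightarrow> nat rtree \<Rightarrow> bool" where
  "same_component E X i S \<longleftrightarrow> (\<exists>K \<in> components E X. i \<in> K \<and> verts S \<subseteq> K)"

text \<open>\<open>rot_tree E i j T T'\<close>: the vertex \<open>j\<close> has parent \<open>i\<close> in \<open>T\<close>, and rotating the edge
  \<open>{i, j}\<close> yields \<open>T'\<close>. In the first rule, \<open>C\<close> collects the subtrees of \<open>i\<close> other than
  the one rooted at \<open>j\<close>, and \<open>D\<close> the subtrees of \<open>j\<close>.\<close>

inductive rot_tree :: "nat rel \<Rightarrow> nat \<Rightarrow> nat \<Rightarrow> nat rtree \<Rightarrow> nat rtree \<Rightarrow> bool"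
  for E :: "nat rel" and i j :: nat where
  rot_here: "Node j D |\<notin>| C \<Longrightarrow>
     H = verts (Node i (finsert (Node j D) C)) \<Longrightarrow>
     rot_tree E i j (Node i (finsert (Node j D) C))
       (Node j (finsert (Node i (C |\<union>| ffilter (same_component E (H - {j}) i) D))
                        (ffilter (\<lambda>S. \<not> same_component E (H - {j}) i S) D)))"
| rot_below: "T |\<notin>| C \<Longrightarrow> rot_tree E i j T T' \<Longrightarrow>
     rot_tree E i j (Node x (finsert T C)) (Node x (finsert T' C))"

definition rot_forest :: "nat rel \<Rightarrow> nat \<Rightarrow> nat \<Rightarrow> forest \<Rightarrow> forest \<Rightarrow> bool" where
  "rot_forest E i j F F' \<longleftrightarrow>
     (\<exists>T T'. T \<in> F \<and> rot_tree E i j T T' \<and> F' = insert T' (F - {T}))"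

text \<open>Rotations of the edge \<open>{i, j}\<close>, seen from its larger end vertex \<open>j\<close>.\<close>

definition up_rotation :: "nat rel \<Rightarrow> nat \<Rightarrow> nat \<Rightarrow> forest \<Rightarrow> forest \<Rightarrow> bool" where
  "up_rotation E j i F F' \<longleftrightarrow> i < j \<and> rot_forest E i j F F'"

definition down_rotation :: "nat rel \<Rightarrow> nat \<Rightarrow> nat \<Rightarrow> forest \<Rightarrow> forest \<Rightarrow> bool" where
  "down_rotation E j i F F' \<longleftrightarrow> i < j \<and> rot_forest E j i F F'"

section \<open>Algorithm R\<close>

text \<open>The state of the algorithm is the nonempty list of forests visited so far, the most recent
  one last.\<close>

definition new_rotation :: "nat rel \<Rightarrow> forest list \<Rightarrow> nat \<Rightarrow> nat \<Rightarrow> forest \<Rightarrow> bool" where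
  "new_rotation E vs j i F' \<longleftrightarrow> F' \<notin> set vs \<and>
     (up_rotation E j i (last vs) F' \<or> down_rotation E j i (last vs) F')"

definition movable :: "nat rel \<Rightarrow> forest list \<Rightarrow> nat \<Rightarrow> bool" where
  "movable E vs j \<longleftrightarrow> (\<exists>i F'. new_rotation E vs j i F')"

definition algR_step :: "nat rel \<Rightarrow> forest list \<Rightarrow> forest \<Rightarrow> bool" where
  "algR_step E vs F' \<longleftrightarrow>
     (\<exists>j. movable E vs j \<and> (\<forall>j'. movable E vs j' \<longrightarrow> j' \<le> j) \<and>
        (\<exists>!i. \<exists>F. new_rotation E vs j i F) \<and>
        (\<exists>i. new_rotation E vs j i F'))"

inductive algR_reaches :: "nat rel \<Rightarrow> forest \<Rightarrow> forest list \<Rightarrow> bool"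
  for E :: "nat rel" and F0 :: forest where
  start: "algR_reaches E F0 [F0]"
| step: "algR_reaches E F0 vs \<Longrightarrow> algR_step E vs F \<Longrightarrow> algR_reaches E F0 (vs @ [F])"

text \<open>\<open>vs\<close> is the complete sequence of visits of a terminated run: both reasons for terminating,
  no movable vertex and more than one candidate edge, amount to there being no step.\<close>

definition algR_visits :: "nat rel \<Rightarrow> forest \<Rightarrow> forest list \<Rightarrow> bool" where
  "algR_visits E F0 vs \<longleftrightarrow> algR_reaches E F0 vs \<and> (\<nexists>F. algR_step E vs F)"

end

theory Submission
  imports Defs
begin

text \<open>An elimination forest is encoded by its descendant order: the pairs \<open>(u, v)\<close> such that \<open>u\<close>
  lies in the subtree rooted at \<open>v\<close>. A rotation exchanges the roles of two adjacent vertices and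
  leaves all other down-sets unchanged.

  The last vertex \<open>n\<close> of a perfect elimination ordering is simplicial, so deleting it from an order
  of \<open>G\<close> yields an order of \<open>G - n\<close>. The neighbours of \<open>n\<close> form a clique and hence lie on one
  root path; the orders above a given one of \<open>G - n\<close> differ in how far up \<open>n\<close> sits on that path,
  and the rotations of \<open>n\<close> move it by one step. When \<open>n\<close> is a root or a leaf, the rotations
  of smaller vertices are exactly those of \<open>G - n\<close>. By induction, the algorithm visits the orders
  of \<open>G - n\<close> one after the other, and for each of them sweeps \<open>n\<close> once along its path,
  alternately upwards and downwards.\<close>

section \<open>Connectivity and elimination orders\<close>

text \<open>On trees a rotation redistributes whole subtrees; on down-sets it alters two sets, one
  of them forced by connectedness, so rotations are studied on orders. The obstacle is that the
  greedy rule looks at the whole history: a smaller vertex may move only when every rotation of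
  \<open>n\<close> is spent, and it must have no competitor. One invariant controls both: whenever a
  smaller vertex is about to move, the visited orders are a union of complete fibres of the
  restriction to \<open>G - n\<close>. Then no rotation of \<open>n\<close> is fresh, and a rotation
  of a smaller vertex is fresh only if its projection is. Simpliciality of \<open>n\<close> enters
  twice: deleting \<open>n\<close> keeps down-sets connected, so \<open>n\<close> has at most one
  child; and its neighbours are pairwise comparable, so its lowest position has a chain of
  ancestors. The start forest has the largest vertex in its lowest position at every stage of the
  induction, so the first sweep begins at an end of a fibre. That visited orders come from forests
  is carried along the run, move by move.\<close>

definition component_of :: "nat rel \<Rightarrow> nat set \<Rightarrow> nat \<Rightarrow> nat set" where
  "component_of E X a = {v \<in> X. (a, v) \<in> (Restr E X)\<^sup>*}"

lemma components_eq: "components E X = component_of E X ` X"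
  by (auto simp: components_def component_of_def)

text \<open>The working form of connectedness: membership is propagated along edges. Most inclusions
  between down-sets below are proved this way.\<close>

lemma connected_on_induct:
  assumes "connected_on E X" "a \<in> X" "a \<in> Z"
    and closed: "\<And>u w. u \<in> X \<Longrightarrow> u \<in> Z \<Longrightarrow> w \<in> X \<Longrightarrow> (u, w) \<in> E \<Longrightarrow> w \<in> Z"
  shows "X \<subseteq> Z"
proof
  fix x assume "x \<in> X"
  then have "(a, x) \<in> (Restr E X)\<^sup>*" using assms(1,2) by (auto simp: connected_on_def)
  then show "x \<in> Z" by (induction rule: rtrancl_induct) (use assms(3) closed in auto)
qed

lemma sym_rtrancl_Restr: "sym E \<Longrightarrow> (a, b) \<in> (Restr E X)\<^sup>* \<Longrightarrow> (b, a) \<in> (Restr E X)\<^sup>*"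
  by (rule symD[OF sym_rtrancl]) (auto simp: sym_def)

lemma connected_onI:
  assumes "sym E" "a \<in> X" "\<And>u. u \<in> X \<Longrightarrow> (a, u) \<in> (Restr E X)\<^sup>*"
  shows "connected_on E X"
  unfolding connected_on_def using assms(2,3) sym_rtrancl_Restr[OF assms(1)]
  by (blast intro: rtrancl_trans)

lemma connected_on_singleton: "connected_on E {a}"
  by (auto simp: connected_on_def)

lemma rtrancl_Restr_mono: "X \<subseteq> Y \<Longrightarrow> (a, b) \<in> (Restr E X)\<^sup>* \<Longrightarrow> (a, b) \<in> (Restr E Y)\<^sup>*"
  by (erule subsetD[OF rtrancl_mono, rotated]) auto

lemma connected_on_insert:
  assumes "sym E" "connected_on E X" "u \<in> X" "(u, m) \<in> E"
  shows "connected_on E (insert m X)"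
proof (rule connected_onI[OF assms(1), of u])
  show "u \<in> insert m X" using assms by auto
next
  fix w assume w: "w \<in> insert m X"
  show "(u, w) \<in> (Restr E (insert m X))\<^sup>*"
  proof (cases "w = m")
    case True
    then show ?thesis using assms by auto
  next
    case False
    then have "(u, w) \<in> (Restr E X)\<^sup>*" using assms w by (auto simp: connected_on_def)
    then show ?thesis by (rule rtrancl_Restr_mono[rotated]) auto
  qed
qed

lemma connected_on_UN:
  assumes "sym E" "m \<in> X" "\<And>x. x \<in> X \<Longrightarrow> \<exists>Y. connected_on E Y \<and> Y \<subseteq> X \<and> m \<in> Y \<and> x \<in> Y"
  shows "connected_on E X"
proof (rule connected_onI[OF assms(1,2)])
  fix x assume "x \<in> X"
  then obtain Y where Y: "connected_on E Y" "Y \<subseteq> X" "m \<in> Y" "x \<in> Y" using assms(3) by blast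
  then have "(m, x) \<in> (Restr E Y)\<^sup>*" by (auto simp: connected_on_def)
  then show "(m, x) \<in> (Restr E X)\<^sup>*" using rtrancl_Restr_mono[OF Y(2)] by blast
qed

text \<open>A path through \<open>m\<close> enters and leaves it by neighbours that coincide or are
  adjacent, so \<open>m\<close> can be cut out.\<close>

lemma connected_on_remove_simplicial:
  assumes "connected_on E X" "X - {m} \<noteq> {}"
    and simplicial: "\<And>u w. u \<in> X - {m} \<Longrightarrow> w \<in> X - {m} \<Longrightarrow> u \<noteq> w \<Longrightarrow>
      (u, m) \<in> E \<Longrightarrow> (m, w) \<in> E \<Longrightarrow> (u, w) \<in> E"
  shows "connected_on E (X - {m})"
  unfolding connected_on_def
proof (intro conjI ballI assms(2))
  fix u v assume u: "u \<in> X - {m}" and v: "v \<in> X - {m}"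
  let ?R = "(Restr E (X - {m}))\<^sup>*"
  have "(u, v) \<in> (Restr E X)\<^sup>*" using assms(1) u v by (auto simp: connected_on_def)
  \<comment> \<open>While the path stands at \<open>m\<close> it has no counterpart in
    \<open>X - {m}\<close>; the invariant then records that every possible exit from
    \<open>m\<close> is already reachable.\<close>
  then have "if v = m then (\<forall>w \<in> X - {m}. (m, w) \<in> E \<longrightarrow> (u, w) \<in> ?R) else (u, v) \<in> ?R"
  proof (induction rule: rtrancl_induct)
    case base
    then show ?case using u by auto
  next
    case (step y z)
    consider "y = m" | "y \<noteq> m" "z = m" | "y \<noteq> m" "z \<noteq> m" by blast
    then show ?case
    proof cases
      case 1
      then show ?thesis using step by (auto split: if_splits)
    next
      case 2
      have uy: "(u, y) \<in> ?R" using step 2 by auto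
      have "(u, w) \<in> ?R" if w: "w \<in> X - {m}" "(m, w) \<in> E" for w
      proof (cases "w = y")
        case True
        then show ?thesis using uy by simp
      next
        case False
        then have "(y, w) \<in> Restr E (X - {m})" using simplicial[of y w] w step 2 by auto
        then show ?thesis using uy by (meson rtrancl.rtrancl_into_rtrancl)
      qed
      then show ?thesis using 2 by auto
    next
      case 3
      then have "(u, y) \<in> ?R" "(y, z) \<in> Restr E (X - {m})" using step by auto
      then show ?thesis using 3 by (meson rtrancl.rtrancl_into_rtrancl)
    qed
  qed
  then show "(u, v) \<in> ?R" using v by auto
qed

lemma component_of_self: "a \<in> X \<Longrightarrow> a \<in> component_of E X a"
  by (auto simp: component_of_def)

lemma component_of_subset: "component_of E X a \<subseteq> X"
  by (auto simp: component_of_def)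

lemma component_of_closed: "u \<in> component_of E X a \<Longrightarrow> w \<in> X \<Longrightarrow> (u, w) \<in> E \<Longrightarrow> w \<in> component_of E X a"
  unfolding component_of_def by (auto intro: rtrancl.rtrancl_into_rtrancl)

lemma connected_on_component_of:
  assumes "sym E" "a \<in> X"
  shows "connected_on E (component_of E X a)"
proof (rule connected_onI[OF assms(1) component_of_self[OF assms(2)]])
  fix u assume "u \<in> component_of E X a"
  then have "(a, u) \<in> (Restr E X)\<^sup>*" by (auto simp: component_of_def)
  then show "(a, u) \<in> (Restr E (component_of E X a))\<^sup>*"
  proof (induction rule: rtrancl_induct)
    case (step y z)
    then have "y \<in> component_of E X a" "z \<in> component_of E X a"
      unfolding component_of_def by (auto intro: rtrancl.rtrancl_into_rtrancl)
    then show ?case using step by (auto intro: rtrancl.rtrancl_into_rtrancl)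
  qed auto
qed

lemma connected_on_subset_component_of:
  assumes "connected_on E Y" "Y \<subseteq> X" "u \<in> Y" "u \<in> component_of E X a"
  shows "Y \<subseteq> component_of E X a"
  using assms component_of_closed[of _ E X a] by (intro connected_on_induct[OF assms(1,3,4)]) auto

lemma component_of_eq:
  assumes "sym E" "b \<in> component_of E X a"
  shows "component_of E X b = component_of E X a"
  using assms unfolding component_of_def
  by (auto intro: rtrancl_trans dest: sym_rtrancl_Restr[OF assms(1)])

lemma components_connected: "sym E \<Longrightarrow> K \<in> components E X \<Longrightarrow> connected_on E K"
  by (auto simp: components_eq connected_on_component_of)

lemma components_subset: "K \<in> components E X \<Longrightarrow> K \<subseteq> X"
  using component_of_subset by (auto simp: components_eq)

lemma Union_components: "\<Union>(components E X) = X"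
  using component_of_subset component_of_self by (fastforce simp: components_eq)

lemma components_disjoint:
  "sym E \<Longrightarrow> K \<in> components E X \<Longrightarrow> L \<in> components E X \<Longrightarrow> u \<in> K \<Longrightarrow> u \<in> L \<Longrightarrow> K = L"
  unfolding components_eq using component_of_eq by (metis imageE)

lemma components_closed:
  "K \<in> components E X \<Longrightarrow> u \<in> K \<Longrightarrow> w \<in> X \<Longrightarrow> (u, w) \<in> E \<Longrightarrow> w \<in> K"
  unfolding components_eq using component_of_closed by auto

lemma finite_components: "finite X \<Longrightarrow> finite (components E X)"
  by (simp add: components_eq)

text \<open>A part contains the component of each of its points because no edge leaves it, and is
  contained in it because it is connected. In \<open>sep\<close> the case \<open>u = w\<close>
  supplies disjointness.\<close>

lemma components_eqI:
  assumes "sym E" "\<Union>P = X" "\<And>Y. Y \<in> P \<Longrightarrow> connected_on E Y"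
    and sep: "\<And>Y Z u w. Y \<in> P \<Longrightarrow> Z \<in> P \<Longrightarrow> u \<in> Y \<Longrightarrow> w \<in> Z \<Longrightarrow> (u, w) \<in> E \<or> u = w \<Longrightarrow> Y = Z"
  shows "components E X = P"
proof -
  have eq: "component_of E X a = Y" if "Y \<in> P" "a \<in> Y" for Y a
  proof
    have "a \<in> X" using that assms(2) by auto
    show "Y \<subseteq> component_of E X a"
      using connected_on_subset_component_of[OF assms(3)[OF that(1)] _ that(2) component_of_self[OF \<open>a \<in> X\<close>]]
        that assms(2) by auto
    show "component_of E X a \<subseteq> Y"
    proof (rule connected_on_induct[OF connected_on_component_of[OF assms(1) \<open>a \<in> X\<close>] component_of_self[OF \<open>a \<in> X\<close>] that(2)])
      fix u w assume u: "u \<in> Y" "w \<in> component_of E X a" "(u, w) \<in> E"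
      then obtain Z where "Z \<in> P" "w \<in> Z" using assms(2) component_of_subset by blast
      then show "w \<in> Y" using sep[OF that(1) \<open>Z \<in> P\<close> u(1)] u by auto
    qed
  qed
  show ?thesis
  proof (intro equalityI subsetI)
    fix K assume "K \<in> components E X"
    then show "K \<in> P" using eq assms(2) by (auto simp: components_eq)
  next
    fix Y assume "Y \<in> P"
    then obtain a where "a \<in> Y" using assms(3) unfolding connected_on_def by blast
    then show "Y \<in> components E X" using eq[OF \<open>Y \<in> P\<close>] \<open>Y \<in> P\<close> assms(2) by (auto simp: components_eq)
  qed
qed

section \<open>Descendant orders and their rotations\<close>

definition below :: "nat rel \<Rightarrow> nat \<Rightarrow> nat set" where
  "below R v = {u. (u, v) \<in> R}"

lemma mem_below [simp]: "u \<in> below R v \<longleftrightarrow> (u, v) \<in> R"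
  by (simp add: below_def)

lemma below_eqI: "(\<And>v. below R v = below S v) \<Longrightarrow> R = S"
  by (auto simp: set_eq_iff)

text \<open>By \<open>chain\<close> the ancestors of a vertex form a path, so the order is that of a
  rooted forest. By \<open>edge\<close> and \<open>conn\<close>, graph edges join only ancestors
  with descendants, and subtrees induce connected subgraphs.\<close>

locale elim_order =
  fixes E :: "nat rel" and V :: "nat set" and R :: "nat rel"
  assumes sub: "(u, v) \<in> R \<Longrightarrow> u \<in> V \<and> v \<in> V"
    and refl: "v \<in> V \<Longrightarrow> (v, v) \<in> R"
    and trans: "(u, v) \<in> R \<Longrightarrow> (v, w) \<in> R \<Longrightarrow> (u, w) \<in> R"
    and antisym: "(u, v) \<in> R \<Longrightarrow> (v, u) \<in> R \<Longrightarrow> u = v"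
    and chain: "(u, v) \<in> R \<Longrightarrow> (u, w) \<in> R \<Longrightarrow> (v, w) \<in> R \<or> (w, v) \<in> R"
    and edge: "u \<in> V \<Longrightarrow> v \<in> V \<Longrightarrow> (u, v) \<in> E \<Longrightarrow> (u, v) \<in> R \<or> (v, u) \<in> R"
    and conn: "v \<in> V \<Longrightarrow> connected_on E (below R v)"
begin

lemma subL: "(u, v) \<in> R \<Longrightarrow> u \<in> V" and subR: "(u, v) \<in> R \<Longrightarrow> v \<in> V"
  using sub by auto

lemma below_subset: "below R v \<subseteq> V"
  using sub by auto

end

lemma elim_order_restrict:
  assumes "elim_order E V R" "L \<subseteq> V" and down: "\<And>u v. v \<in> L \<Longrightarrow> (u, v) \<in> R \<Longrightarrow> u \<in> L"
  shows "elim_order E L (Restr R L)"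
proof -
  interpret elim_order E V R by fact
  have b: "below (Restr R L) v = below R v" if "v \<in> L" for v
    using down that by auto
  show ?thesis
  proof
    show "connected_on E (below (Restr R L) v)" if "v \<in> L" for v
      using that assms(2) conn b by auto
    show "(u, v) \<in> Restr R L \<or> (v, u) \<in> Restr R L" if "u \<in> L" "v \<in> L" "(u, v) \<in> E" for u v
      using that assms(2) edge[of u v] by auto
  qed (use assms(2) refl in \<open>auto intro: trans antisym dest: chain\<close>)
qed

text \<open>The rotation of the edge between \<open>i\<close> and its child \<open>j\<close>. That nothing lies between the two
  vertices is implied by the invariance of the other down-sets.\<close>

definition rot_order :: "nat rel \<Rightarrow> nat set \<Rightarrow> nat \<Rightarrow> nat \<Rightarrow> nat rel \<Rightarrow> nat rel \<Rightarrow> bool" where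
  "rot_order E V i j R R' \<longleftrightarrow> elim_order E V R \<and> elim_order E V R' \<and> i \<noteq> j \<and> (j, i) \<in> R \<and>
     below R' j = below R i \<and> (\<forall>v. v \<noteq> i \<longrightarrow> v \<noteq> j \<longrightarrow> below R' v = below R v)"

text \<open>The definition prescribes only down-sets that the two orders share and leaves
  \<open>below R' i\<close> open; this makes it symmetric, so rotating back is again a
  rotation.\<close>

lemma rot_order_sym:
  assumes "rot_order E V i j R R'"
  shows "rot_order E V j i R' R"
proof -
  interpret elim_order E V R using assms by (simp add: rot_order_def)
  have "(i, i) \<in> R" using assms refl subR by (auto simp: rot_order_def)
  then have "(i, j) \<in> R'" using assms by (auto simp: rot_order_def below_def)
  then show ?thesis using assms by (auto simp: rot_order_def)
qed

text \<open>The down-set left open is forced: it is connected and avoids \<open>j\<close>, hence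
  lies in the component, and no edge of \<open>below R i - {j}\<close> leads out of it. This is the
  clause about the component of \<open>i\<close> in \<open>H - j\<close> from the definition of a
  rotation.\<close>

lemma rot_order_below:
  assumes "rot_order E V i j R R'"
  shows "below R' i = component_of E (below R i - {j}) i"
proof
  interpret R: elim_order E V R using assms by (simp add: rot_order_def)
  interpret R': elim_order E V R' using assms by (simp add: rot_order_def)
  have ij: "i \<noteq> j" "(j, i) \<in> R" "(i, j) \<in> R'" using assms rot_order_sym[OF assms]
    by (auto simp: rot_order_def)
  have b: "below R' j = below R i" "\<And>v. v \<noteq> i \<Longrightarrow> v \<noteq> j \<Longrightarrow> below R' v = below R v"
    using assms by (auto simp: rot_order_def)
  have i: "i \<in> V" using ij R.sub by auto
  have sub: "below R' i \<subseteq> below R i - {j}"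
  proof
    fix u assume "u \<in> below R' i"
    then show "u \<in> below R i - {j}"
      using ij b(1) R'.trans[of u i j] R'.antisym[of i j] by (auto simp: set_eq_iff)
  qed
  have mem: "i \<in> below R i - {j}" using ij i R.refl by auto
  show "below R' i \<subseteq> component_of E (below R i - {j}) i"
    using connected_on_subset_component_of[OF R'.conn[OF i] sub _ component_of_self[OF mem]] R'.refl[OF i] by auto
  show "component_of E (below R i - {j}) i \<subseteq> below R' i"
  proof
    fix x assume "x \<in> component_of E (below R i - {j}) i"
    then have "(i, x) \<in> (Restr E (below R i - {j}))\<^sup>*" by (simp add: component_of_def)
    then show "x \<in> below R' i"
    proof (induction rule: rtrancl_induct)
      case base
      show ?case using R'.refl[OF i] by simp
    next
      case (step u w)
      then have w: "(u, i) \<in> R'" "(w, i) \<in> R" "w \<noteq> j" "(u, w) \<in> E" by auto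
      from R'.edge[OF R'.subL[OF w(1)] R.subL[OF w(2)] w(4)] show ?case
      proof
        assume "(u, w) \<in> R'"
        from R'.chain[OF this w(1)] show ?case
        proof
          assume iw: "(i, w) \<in> R'"
          show ?case
          proof (cases "w = i")
            case True
            then show ?thesis using R'.refl[OF i] by simp
          next
            case False
            \<comment> \<open>As \<open>w\<close> is neither \<open>i\<close> nor \<open>j\<close>,
              its down-set is common to both orders; transferred to \<open>R\<close>, the relation
              contradicts \<open>(w, i) \<in> R\<close>.\<close>
            then have "(i, w) \<in> R" using iw b(2)[of w] w(3) by (auto simp: set_eq_iff)
            then show ?thesis using R.antisym w(2) False by auto
          qed
        qed auto
      next
        assume "(w, u) \<in> R'"
        then show ?case using w(1) R'.trans by auto
      qed
    qed
  qed
qed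

lemma rot_order_unique:
  assumes "rot_order E V i j R R'" "rot_order E V i j R R''"
  shows "R' = R''"
proof (rule below_eqI)
  fix v
  have "v = i \<or> v = j \<or> (v \<noteq> i \<and> v \<noteq> j)" by blast
  then show "below R' v = below R'' v"
    using assms rot_order_below[OF assms(1)] rot_order_below[OF assms(2)] by (auto simp: rot_order_def)
qed

text \<open>The tree edge with parent \<open>i\<close> and child \<open>j\<close>.\<close>

definition covers :: "nat rel \<Rightarrow> nat \<Rightarrow> nat \<Rightarrow> bool" where
  "covers R i j \<longleftrightarrow> i \<noteq> j \<and> (j, i) \<in> R \<and> (\<forall>w. (j, w) \<in> R \<longrightarrow> (w, i) \<in> R \<longrightarrow> w = i \<or> w = j)"

text \<open>A vertex strictly between would keep its down-set and thus lie both above and below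
  \<open>j\<close> in \<open>R'\<close>.\<close>

lemma rot_order_covers:
  assumes "rot_order E V i j R R'"
  shows "covers R i j"
proof -
  interpret R: elim_order E V R using assms by (simp add: rot_order_def)
  interpret R': elim_order E V R' using assms by (simp add: rot_order_def)
  have ij: "i \<noteq> j" "(j, i) \<in> R" using assms by (auto simp: rot_order_def)
  have "w = i \<or> w = j" if w: "(j, w) \<in> R" "(w, i) \<in> R" for w
  proof (rule ccontr)
    assume n: "\<not> ?thesis"
    then have "(j, w) \<in> R'" "(w, j) \<in> R'" using assms w by (auto simp: rot_order_def below_def)
    then show False using n R'.antisym by blast
  qed
  then show ?thesis using ij by (auto simp: covers_def)
qed

text \<open>The new order is written down by its down-sets: \<open>j\<close> inherits the subtree of
  \<open>i\<close>, and \<open>i\<close> gets the component dictated by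
  \<open>rot_order_below\<close>.\<close>

lemma rot_order_exists:
  assumes "sym E" "elim_order E V R" "covers R i j"
  shows "\<exists>R'. rot_order E V i j R R'"
proof -
  interpret elim_order E V R by fact
  have ij: "i \<noteq> j" "(j, i) \<in> R" and cov: "\<And>w. (j, w) \<in> R \<Longrightarrow> (w, i) \<in> R \<Longrightarrow> w = i \<or> w = j"
    using assms(3) by (auto simp: covers_def)
  define K where "K = component_of E (below R i - {j}) i"
  define t where "t = (\<lambda>v. if v = j then below R i else if v = i then K else below R v)"
  define R' where "R' = {(u, v). u \<in> t v}"
  have V: "i \<in> V" "j \<in> V" using ij sub by auto
  have K: "K \<subseteq> below R i - {j}" "i \<in> K" "connected_on E K"
    using component_of_subset component_of_self[of i] connected_on_component_of[OF assms(1), of i] ij refl[OF V(1)]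
    unfolding K_def by (blast, auto)
  have closed: "w \<in> K" if "u \<in> K" "(w, i) \<in> R" "w \<noteq> j" "(u, w) \<in> E" for u w
    using that component_of_closed unfolding K_def by auto
  \<comment> \<open>A subtree inside that of \<open>i\<close>, with root other than \<open>i\<close>
    and \<open>j\<close>, is connected and avoids \<open>j\<close>; if it meets \<open>K\<close>,
    then \<open>K\<close> contains it. This serves transitivity and \<open>chain\<close> at
    \<open>i\<close>.\<close>
  have bK: "below R v \<subseteq> K" if "(v, i) \<in> R" "v \<noteq> i" "v \<noteq> j" "(u, v) \<in> R" "u \<in> K" for u v
  proof -
    have "below R v \<subseteq> below R i - {j}" using that(1-3) cov[of v] trans[of _ v i] by auto
    from connected_on_subset_component_of[OF conn[OF subL[OF that(1)]] this] that(4,5)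
    show ?thesis unfolding K_def by simp
  qed
  have up: "(i, w) \<in> R" if "(j, w) \<in> R" "w \<noteq> j" for w
    using chain[OF that(1) ij(2)] cov that refl V by auto
  have rj: "(u, j) \<in> R' \<longleftrightarrow> (u, i) \<in> R" for u by (auto simp: R'_def t_def)
  have ri: "(u, i) \<in> R' \<longleftrightarrow> u \<in> K" for u using ij by (auto simp: R'_def t_def)
  have ro: "(u, v) \<in> R' \<longleftrightarrow> (u, v) \<in> R" if "v \<noteq> i" "v \<noteq> j" for u v using that by (auto simp: R'_def t_def)
  have KR: "u \<in> K \<Longrightarrow> (u, i) \<in> R" "j \<notin> K" for u using K(1) by auto
  have b: "below R' v = t v" for v by (auto simp: R'_def)
  have "elim_order E V R'"
  proof
    fix u v assume uv: "(u, v) \<in> R'"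
    consider "v = j" | "v = i" | "v \<noteq> i" "v \<noteq> j" by blast
    then show "u \<in> V \<and> v \<in> V"
      by cases (use uv rj ri ro K(1) sub V in auto)
  next
    fix v assume "v \<in> V"
    consider "v = j" | "v = i" | "v \<noteq> i" "v \<noteq> j" by blast
    then show "(v, v) \<in> R'"
      by cases (use rj ri ro K(2) ij(2) refl \<open>v \<in> V\<close> in auto)
  next
    fix u v w assume uv: "(u, v) \<in> R'" and vw: "(v, w) \<in> R'"
    consider "v = j" | "v = i" | "v \<noteq> i" "v \<noteq> j" by blast
    then show "(u, w) \<in> R'"
    proof cases
      case 1
      have "w \<noteq> i" using vw ri KR 1 by auto
      then show ?thesis using uv vw up trans 1 rj ro by metis
    next
      case 2
      then show ?thesis using uv vw rj ri ro KR trans by metis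
    next
      case 3
      then have "(u, v) \<in> R" using uv ro by auto
      then show ?thesis
        using 3 vw rj ri ro KR trans bK[of v v] refl[of v] sub by (metis mem_below subsetD)
    qed
  next
    fix u v assume uv: "(u, v) \<in> R'" and vu: "(v, u) \<in> R'"
    have *: False if "v = j" "u \<noteq> j" "(u, v) \<in> R'" "(v, u) \<in> R'" for u v
      using that rj ri ro KR up antisym by metis
    have **: "u = v" if "v = i" "u \<noteq> j" "(u, v) \<in> R'" "(v, u) \<in> R'" for u v
      using that rj ri ro KR antisym by metis
    show "u = v" using * ** ro uv vu antisym by metis
  next
    fix u v w assume uv: "(u, v) \<in> R'" and uw: "(u, w) \<in> R'"
    have 1: "(j, b) \<in> R' \<or> (b, j) \<in> R'" if "(u, j) \<in> R'" "(u, b) \<in> R'" "b \<noteq> i" "b \<noteq> j" for b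
      using that chain[of u i b] ij trans rj ro by metis
    have 2: "(i, b) \<in> R' \<or> (b, i) \<in> R'" if "(u, i) \<in> R'" "(u, b) \<in> R'" "b \<noteq> i" "b \<noteq> j" for b
      using that chain[of u i b] bK[of b u] KR ri ro refl sub by (metis mem_below subsetD)
    have 3: "(i, j) \<in> R'" using rj refl V by auto
    have 4: "(i, i) \<in> R'" "(j, j) \<in> R'" using rj ri K ij by auto
    show "(v, w) \<in> R' \<or> (w, v) \<in> R'"
      using 1 2 3 4 uv uw chain ro by metis
  next
    fix u v assume uv: "u \<in> V" "v \<in> V" "(u, v) \<in> E"
    have *: "(u, v) \<in> R' \<or> (v, u) \<in> R'" if "(u, v) \<in> R" "(u, v) \<in> E" for u v
    proof -
      consider "v = j" | "v = i" "u = j" | "v = i" "u \<noteq> j" | "v \<noteq> i" "v \<noteq> j" by blast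
      then show ?thesis
      proof cases
        case 1
        then show ?thesis using rj trans that ij by blast
      next
        case 2
        then show ?thesis using rj refl V by auto
      next
        case 3
        have "(i, u) \<in> E" using that 3 symD[OF assms(1)] by auto
        then show ?thesis using closed[OF K(2), of u] that 3 ri by auto
      next
        case 4
        then show ?thesis using ro that by auto
      qed
    qed
    show "(u, v) \<in> R' \<or> (v, u) \<in> R'"
      using edge[OF uv] *[OF _ uv(3)] *[of v u] symD[OF assms(1) uv(3)] by blast
  next
    fix v assume "v \<in> V"
    then show "connected_on E (below R' v)" unfolding b using conn V K(3) by (auto simp: t_def)
  qed
  then have "rot_order E V i j R R'"
    unfolding rot_order_def using assms(2) ij by (auto simp: b t_def)
  then show ?thesis ..
qed

section \<open>Greedy sequences and zigzag lifts\<close>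

text \<open>An abstract Algorithm R: \<open>A j i x x'\<close> is a move along the edge with larger
  end \<open>j\<close> and smaller end \<open>i\<close>; the list is the history, current state
  last.\<close>

definition fresh_move :: "(nat \<Rightarrow> nat \<Rightarrow> 'a \<Rightarrow> 'a \<Rightarrow> bool) \<Rightarrow> 'a list \<Rightarrow> nat \<Rightarrow> nat \<Rightarrow> 'a \<Rightarrow> bool" where
  "fresh_move A vs j i x \<longleftrightarrow> x \<notin> set vs \<and> A j i (last vs) x"

text \<open>Maximality of the label and absence of competitors in one condition: any fresh move
  whose label is at least \<open>j\<close> is this very move.\<close>

definition best_move :: "(nat \<Rightarrow> nat \<Rightarrow> 'a \<Rightarrow> 'a \<Rightarrow> bool) \<Rightarrow> 'a list \<Rightarrow> 'a \<Rightarrow> bool" where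
  "best_move A vs x \<longleftrightarrow> (\<exists>j i. fresh_move A vs j i x \<and>
     (\<forall>j' i' x'. fresh_move A vs j' i' x' \<longrightarrow> j' < j \<or> (j' = j \<and> i' = i \<and> x' = x)))"

inductive greedy :: "(nat \<Rightarrow> nat \<Rightarrow> 'a \<Rightarrow> 'a \<Rightarrow> bool) \<Rightarrow> 'a \<Rightarrow> 'a list \<Rightarrow> bool"
  for A :: "nat \<Rightarrow> nat \<Rightarrow> 'a \<Rightarrow> 'a \<Rightarrow> bool" and x0 :: 'a where
  greedy_start: "greedy A x0 [x0]"
| greedy_step: "greedy A x0 vs \<Longrightarrow> best_move A vs x \<Longrightarrow> greedy A x0 (vs @ [x])"

lemma greedy_nonempty: "greedy A x0 vs \<Longrightarrow> vs \<noteq> []"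
  by (induction rule: greedy.induct) auto

lemma greedy_distinct: "greedy A x0 vs \<Longrightarrow> distinct vs"
  by (induction rule: greedy.induct) (auto simp: best_move_def fresh_move_def)

lemma greedy_take1: "greedy A x0 vs \<Longrightarrow> take 1 vs = [x0]"
  by (induction rule: greedy.induct) (auto dest: greedy_nonempty simp: Suc_le_eq)

text \<open>Each entry is forced by the prefix before it, so a run of Algorithm R can be compared
  with the sequence entry by entry.\<close>

lemma greedy_nth:
  "greedy A x0 vs \<Longrightarrow> 0 < k \<Longrightarrow> k < length vs \<Longrightarrow> best_move A (take k vs) (vs ! k)"
proof (induction rule: greedy.induct)
  case (greedy_step vs x)
  then show ?case by (cases "k = length vs") (auto simp: nth_append)
qed auto

text \<open>The states \<open>X\<close> are fibred over the states \<open>Y\<close>; the moves of the largest label \<open>m\<close> walk along a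
  fibre, on which \<open>pos\<close> is injective, and all other moves at the two ends of a fibre are those
  of \<open>Y\<close>. A greedy sequence in \<open>Y\<close> then lifts to one in \<open>X\<close> that sweeps through the fibres in
  alternating directions.\<close>

locale zigzag =
  fixes A :: "nat \<Rightarrow> nat \<Rightarrow> 'a \<Rightarrow> 'a \<Rightarrow> bool" and B :: "nat \<Rightarrow> nat \<Rightarrow> 'b \<Rightarrow> 'b \<Rightarrow> bool"
    and X :: "'a set" and Y :: "'b set" and \<pi> :: "'a \<Rightarrow> 'b" and pos :: "'a \<Rightarrow> int"
    and top bot :: "'b \<Rightarrow> 'a" and m :: nat
  assumes A_closed: "A j i x x' \<Longrightarrow> x \<in> X \<and> x' \<in> X \<and> j \<le> m"
    and B_closed: "B j i y y' \<Longrightarrow> y \<in> Y \<and> y' \<in> Y"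
    and A_max: "A m i x x' \<Longrightarrow> \<pi> x' = \<pi> x \<and> (pos x' = pos x + 1 \<or> pos x' = pos x - 1)"
    and A_max_label: "A m i x x' \<Longrightarrow> A m i' x x' \<Longrightarrow> i = i'"
    and A_det: "A j i x x' \<Longrightarrow> A j i x x'' \<Longrightarrow> x' = x''"
    and pos_inj: "x \<in> X \<Longrightarrow> x' \<in> X \<Longrightarrow> \<pi> x = \<pi> x' \<Longrightarrow> pos x = pos x' \<Longrightarrow> x = x'"
    and ascend: "x \<in> X \<Longrightarrow> x'' \<in> X \<Longrightarrow> \<pi> x = \<pi> x'' \<Longrightarrow> pos x < pos x'' \<Longrightarrow>
      \<exists>i x'. A m i x x' \<and> pos x' = pos x + 1"
    and descend: "x \<in> X \<Longrightarrow> x'' \<in> X \<Longrightarrow> \<pi> x = \<pi> x'' \<Longrightarrow> pos x'' < pos x \<Longrightarrow>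
      \<exists>i x'. A m i x x' \<and> pos x' = pos x - 1"
    and A_proj: "A j i x x' \<Longrightarrow> j \<noteq> m \<Longrightarrow> B j i (\<pi> x) (\<pi> x')"
    and B_top: "B j i y y' \<Longrightarrow> A j i (top y) (top y')"
    and B_bot: "B j i y y' \<Longrightarrow> A j i (bot y) (bot y')"
    and top_fibre: "y \<in> Y \<Longrightarrow> top y \<in> X \<and> \<pi> (top y) = y"
    and bot_fibre: "y \<in> Y \<Longrightarrow> bot y \<in> X \<and> \<pi> (bot y) = y"
    and pos_bounds: "x \<in> X \<Longrightarrow> pos (top (\<pi> x)) \<le> pos x \<and> pos x \<le> pos (bot (\<pi> x))"
begin

text \<open>\<open>\<sigma>\<close> is the direction. The visited part of the fibre is the stretch
  up to the current state, so among the \<open>m\<close>-moves only the one ahead is fresh, and it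
  beats all others because \<open>m\<close> is the largest label. The sweep stops at
  \<open>b\<close> with the fibre exhausted.\<close>

lemma sweep:
  fixes \<sigma> :: int
  assumes \<sigma>: "\<sigma> = 1 \<or> \<sigma> = -1"
    and "b \<in> X" "\<pi> b = y" and b_max: "\<And>x. x \<in> X \<Longrightarrow> \<pi> x = y \<Longrightarrow> \<sigma> * pos x \<le> \<sigma> * pos b"
    and "greedy A x0 xs" "last xs \<in> X" "\<pi> (last xs) = y"
    and "\<And>x. x \<in> X \<Longrightarrow> \<pi> x = y \<Longrightarrow> x \<in> set xs \<longleftrightarrow> \<sigma> * pos x \<le> \<sigma> * pos (last xs)"
  shows "\<exists>xs'. greedy A x0 xs' \<and> set xs' = set xs \<union> {x \<in> X. \<pi> x = y} \<and> last xs' = b"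
  using assms(5-8)
proof (induction "nat (\<sigma> * pos b - \<sigma> * pos (last xs))" arbitrary: xs rule: less_induct)
  case less
  note vis = less.prems(4)
  show ?case
  proof (cases "\<sigma> * pos (last xs) < \<sigma> * pos b")
    case False
    then have "\<sigma> * pos (last xs) = \<sigma> * pos b" using b_max[OF less.prems(2,3)] by simp
    then have "last xs = b"
      using pos_inj[of "last xs" b] \<sigma> less.prems(2,3) assms(2,3) by (elim disjE) simp_all
    moreover have "{x \<in> X. \<pi> x = y} \<subseteq> set xs" using vis b_max calculation by auto
    ultimately show ?thesis using less.prems(1) by blast
  next
    case True
    have "\<exists>i x'. A m i (last xs) x' \<and> \<sigma> * pos x' = \<sigma> * pos (last xs) + 1"
      using \<sigma>
    proof
      assume "\<sigma> = 1"
      then show ?thesis using ascend[of "last xs" b] True less.prems(2,3) assms(2,3) by auto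
    next
      assume "\<sigma> = -1"
      then show ?thesis using descend[of "last xs" b] True less.prems(2,3) assms(2,3) by fastforce
    qed
    then obtain i x where x: "A m i (last xs) x" "\<sigma> * pos x = \<sigma> * pos (last xs) + 1" by blast
    have xX: "x \<in> X" "\<pi> x = y" using A_closed[OF x(1)] A_max[OF x(1)] less.prems(3) by auto
    have uniq: "x' = x" if "A m i' (last xs) x'" "x' \<notin> set xs" for i' x'
    proof -
      have x': "x' \<in> X" "\<pi> x' = y" using A_closed[OF that(1)] A_max[OF that(1)] less.prems(3) by auto
      then have "\<sigma> * pos x' > \<sigma> * pos (last xs)" using vis that by auto
      then have "pos x' = pos x" using A_max[OF that(1)] x(2) \<sigma> by (elim disjE) simp_all
      then show ?thesis using pos_inj x' xX by auto
    qed
    have new: "x \<notin> set xs" using vis[OF xX] x(2) by auto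
    have "best_move A xs x"
      unfolding best_move_def fresh_move_def
    proof (intro exI conjI allI impI)
      fix j' i' x' assume "x' \<notin> set xs \<and> A j' i' (last xs) x'"
      \<comment> \<open>The target being unique, \<open>A_max_label\<close> makes the edge unique as
        well.\<close>
      then show "j' < m \<or> j' = m \<and> i' = i \<and> x' = x"
        using A_closed[of j' i' "last xs" x'] uniq[of i' x'] A_max_label[of i' "last xs" x i] x(1)
        by (cases "j' = m") auto
    qed (rule new, rule x(1))
    then have g: "greedy A x0 (xs @ [x])" using less.prems(1) greedy_step by metis
    have set: "x' \<in> set (xs @ [x]) \<longleftrightarrow> \<sigma> * pos x' \<le> \<sigma> * pos (last (xs @ [x]))"
      if "x' \<in> X" "\<pi> x' = y" for x'
    proof -
      have "\<sigma> * pos x' = \<sigma> * pos x \<longleftrightarrow> x' = x" using pos_inj[of x' x] that xX \<sigma>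
        by (elim disjE) auto
      then show ?thesis using vis[OF that] x(2) by auto
    qed
    have "\<exists>xs'. greedy A x0 xs' \<and> set xs' = set (xs @ [x]) \<union> {x \<in> X. \<pi> x = y} \<and> last xs' = b"
      by (rule less.hyps[OF _ g]) (use x(2) xX True set in auto)
    then show ?thesis using xX by auto
  qed
qed

text \<open>Invariant: the visited states are the complete fibres over \<open>ys\<close>, and the
  current state is an end of the last one. No \<open>m\<close>-move is then fresh, so the best move
  of \<open>Y\<close> lifts at this end and enters the next fibre at the end of the same kind, from
  where \<open>sweep\<close> runs to the other.\<close>

theorem greedy_lift:
  assumes "greedy B y0 ys" "y0 \<in> Y"
  shows "\<exists>xs. greedy A (bot y0) xs \<and> set xs = {x \<in> X. \<pi> x \<in> set ys} \<and> last ys \<in> Y \<and>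
    last xs \<in> {top (last ys), bot (last ys)}"
  using assms(1)
proof (induction rule: greedy.induct)
  case greedy_start
  have b: "pos (top y0) \<le> pos x" "pos x \<le> pos (bot y0)" if "x \<in> X" "\<pi> x = y0" for x
    using pos_bounds[of x] that by auto
  have "\<exists>xs. greedy A (bot y0) xs \<and> set xs = set [bot y0] \<union> {x \<in> X. \<pi> x = y0} \<and> last xs = top y0"
  \<comment> \<open>\<open>pos\<close> is largest at \<open>bot\<close>, so the first sweep goes
    towards smaller positions.\<close>
  proof (rule sweep[where \<sigma> = "-1"])
    fix x assume x: "x \<in> X" "\<pi> x = y0"
    have eq: "x = bot y0 \<longleftrightarrow> pos x = pos (bot y0)"
      by (rule iffI) (simp, simp add: pos_inj[OF x(1)] x bot_fibre[OF assms(2)])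
    have "pos (bot y0) \<le> pos x \<longleftrightarrow> pos x = pos (bot y0)" using b(2)[OF x] by linarith
    then show "x \<in> set [bot y0] \<longleftrightarrow> - 1 * pos x \<le> - 1 * pos (last [bot y0])"
      using eq by simp
    show "- 1 * pos x \<le> - 1 * pos (top y0)" using b(1)[OF x] by simp
  qed (use top_fibre[OF assms(2)] bot_fibre[OF assms(2)] in \<open>simp_all add: greedy.greedy_start\<close>)
  moreover have "set [bot y0] \<union> {x \<in> X. \<pi> x = y0} = {x \<in> X. \<pi> x \<in> set [y0]}"
    using bot_fibre[OF assms(2)] by simp blast
  ultimately show ?case using assms(2) by force
next
  case (greedy_step ys y)
  from greedy_step.IH obtain xs where xs: "greedy A (bot y0) xs" "set xs = {x \<in> X. \<pi> x \<in> set ys}"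
    "last ys \<in> Y" "last xs \<in> {top (last ys), bot (last ys)}" by blast
  from greedy_step.hyps(2) obtain j i where ji: "y \<notin> set ys" "B j i (last ys) y"
    and best: "\<And>j' i' y'. y' \<notin> set ys \<Longrightarrow> B j' i' (last ys) y' \<Longrightarrow> j' < j \<or> (j' = j \<and> i' = i \<and> y' = y)"
    unfolding best_move_def fresh_move_def by blast
  have yY: "y \<in> Y" using B_closed[OF ji(2)] by auto
  have lys: "last ys \<in> set ys" using greedy_nonempty[OF greedy_step.hyps(1)] by auto
  have \<pi>l: "\<pi> (last xs) = last ys" using xs(4) top_fibre[OF xs(3)] bot_fibre[OF xs(3)] by auto
  \<comment> \<open>Common to both directions: the next fibre is entered at \<open>e\<close>, and
    \<open>e'\<close> is its opposite end.\<close>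
  have nxt: "\<exists>xs'. greedy A (bot y0) xs' \<and> set xs' = set xs \<union> {x \<in> X. \<pi> x = y} \<and> last xs' = e'"
    if e: "A j i (last xs) e" "e \<in> X" "\<pi> e = y" "e' \<in> X" "\<pi> e' = y" and \<sigma>: "\<sigma> = 1 \<or> \<sigma> = -1"
      and bnd: "\<And>x. x \<in> X \<Longrightarrow> \<pi> x = y \<Longrightarrow> \<sigma> * pos e \<le> \<sigma> * pos x \<and> \<sigma> * pos x \<le> \<sigma> * pos e'"
    for e e' and \<sigma> :: int
  proof -
    have "best_move A xs e"
      unfolding best_move_def fresh_move_def
    proof (intro exI conjI allI impI)
      show "e \<notin> set xs" using xs(2) e(3) ji(1) by simp
      show "A j i (last xs) e" by fact
      fix j' i' x' assume x': "x' \<notin> set xs \<and> A j' i' (last xs) x'"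
      have "j' \<noteq> m"
      proof
        assume "j' = m"
        then have "\<pi> x' \<in> set ys" using A_max[of i' "last xs" x'] x' \<pi>l lys by simp
        then show False using A_closed[of j' i' "last xs" x'] x' xs(2) by blast
      qed
      then have "B j' i' (last ys) (\<pi> x')" using A_proj[of j' i' "last xs" x'] x' \<pi>l by simp
      \<comment> \<open>The fibres over \<open>ys\<close> are complete, so a fresh state has a fresh
        projection.\<close>
      moreover have "\<pi> x' \<notin> set ys" using x' A_closed[of j' i' "last xs" x'] xs(2) by blast
      ultimately have "j' < j \<or> (j' = j \<and> i' = i \<and> \<pi> x' = y)" using best by blast
      then show "j' < j \<or> j' = j \<and> i' = i \<and> x' = e" using x' e(1) A_det[of j i "last xs" x' e] by auto
    qed
    then have g: "greedy A (bot y0) (xs @ [e])" using xs(1) greedy.greedy_step by metis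
    have "\<exists>xs'. greedy A (bot y0) xs' \<and> set xs' = set (xs @ [e]) \<union> {x \<in> X. \<pi> x = y} \<and> last xs' = e'"
    proof (rule sweep[OF \<sigma> e(4,5) _ g])
      fix x assume x: "x \<in> X" "\<pi> x = y"
      have "\<sigma> * pos x \<le> \<sigma> * pos e \<longleftrightarrow> \<sigma> * pos x = \<sigma> * pos e" using bnd[OF x] by linarith
      also have "\<dots> \<longleftrightarrow> pos x = pos e" using \<sigma> by auto
      also have "\<dots> \<longleftrightarrow> x = e" using pos_inj[OF x(1) e(2)] x(2) e(3) by metis
      finally have eq: "\<sigma> * pos x \<le> \<sigma> * pos e \<longleftrightarrow> x = e" .
      have "x \<notin> set xs" using xs(2) x(2) ji(1) by simp
      then show "x \<in> set (xs @ [e]) \<longleftrightarrow> \<sigma> * pos x \<le> \<sigma> * pos (last (xs @ [e]))"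
        using eq by simp
      show "\<sigma> * pos x \<le> \<sigma> * pos e'" using bnd[OF x] by simp
    qed (use e(2,3) in simp_all)
    moreover have "set (xs @ [e]) \<union> {x \<in> X. \<pi> x = y} = set xs \<union> {x \<in> X. \<pi> x = y}"
      using e(2,3) by simp blast
    ultimately show ?thesis by simp
  qed
  have b: "pos (top y) \<le> pos x" "pos x \<le> pos (bot y)" if "x \<in> X" "\<pi> x = y" for x
    using pos_bounds[of x] that by auto
  have "\<exists>xs'. greedy A (bot y0) xs' \<and> set xs' = set xs \<union> {x \<in> X. \<pi> x = y} \<and>
      last xs' \<in> {top y, bot y}"
  proof (cases "last xs = top (last ys)")
    case True
    then have "A j i (last xs) (top y)" using B_top[OF ji(2)] by simp
    then have "\<exists>xs'. greedy A (bot y0) xs' \<and> set xs' = set xs \<union> {x \<in> X. \<pi> x = y} \<and> last xs' = bot y"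
      by (rule nxt[where \<sigma> = 1]) (use top_fibre[OF yY] bot_fibre[OF yY] b in simp_all)
    then show ?thesis by blast
  next
    case False
    then have "A j i (last xs) (bot y)" using B_bot[OF ji(2)] xs(4) by simp
    then have "\<exists>xs'. greedy A (bot y0) xs' \<and> set xs' = set xs \<union> {x \<in> X. \<pi> x = y} \<and> last xs' = top y"
      by (rule nxt[where \<sigma> = "-1"]) (use top_fibre[OF yY] bot_fibre[OF yY] b in simp_all)
    then show ?thesis by blast
  qed
  then obtain xs' where xs': "greedy A (bot y0) xs'" "set xs' = set xs \<union> {x \<in> X. \<pi> x = y}"
    "last xs' \<in> {top y, bot y}" by blast
  show ?case
    by (rule exI[of _ xs']) (use xs' xs(2) yY in auto)
qed

end

section \<open>Adding a simplicial vertex\<close>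

text \<open>\<open>m\<close> as a root, above every tree of \<open>S\<close> that contains a
  neighbour of \<open>m\<close>: \<open>r\<close> witnesses that \<open>w\<close> and the neighbour
  \<open>u\<close> lie in one tree.\<close>

definition ext_top :: "nat rel \<Rightarrow> nat \<Rightarrow> nat rel \<Rightarrow> nat rel" where
  "ext_top E m S = S \<union> {(m, m)} \<union> {(w, m) | w. \<exists>r u. (w, r) \<in> S \<and> (u, r) \<in> S \<and> (u, m) \<in> E}"

text \<open>\<open>m\<close> as a leaf whose ancestors are all vertices with a neighbour of
  \<open>m\<close> in their subtree, the most that connected down-sets permit.\<close>

definition ext_bot :: "nat rel \<Rightarrow> nat \<Rightarrow> nat rel \<Rightarrow> nat rel" where
  "ext_bot E m S = S \<union> {(m, m)} \<union> {(m, v) | v. \<exists>u. (u, v) \<in> S \<and> (u, m) \<in> E}"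

text \<open>The cardinality of this set is the depth of \<open>m\<close>, which serves as the
  position within a fibre.\<close>

definition ancestors :: "nat \<Rightarrow> nat rel \<Rightarrow> nat set" where
  "ancestors m R = {v. v \<noteq> m \<and> (m, v) \<in> R}"

text \<open>\<open>j\<close> is the larger end; the first disjunct is its up-rotation, the second
  its down-rotation.\<close>

definition move :: "nat rel \<Rightarrow> nat set \<Rightarrow> nat \<Rightarrow> nat \<Rightarrow> nat rel \<Rightarrow> nat rel \<Rightarrow> bool" where
  "move E V j i R R' \<longleftrightarrow> i < j \<and> (rot_order E V i j R R' \<or> rot_order E V j i R R')"

locale simplicial_extension =
  fixes E :: "nat rel" and W :: "nat set" and m :: nat
  assumes symE: "sym E" and finW: "finite W" and less_m: "\<And>w. w \<in> W \<Longrightarrow> w < m"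
    and simplicial: "u \<in> W \<Longrightarrow> w \<in> W \<Longrightarrow> u \<noteq> w \<Longrightarrow> (u, m) \<in> E \<Longrightarrow> (w, m) \<in> E \<Longrightarrow> (u, w) \<in> E"
begin

abbreviation V :: "nat set" where "V \<equiv> insert m W"

lemma m_notin: "m \<notin> W"
  using less_m by blast

lemma elim_order_finite:
  assumes "elim_order E V R"
  shows "finite (ancestors m R)" "finite (below R v)"
proof -
  interpret elim_order E V R by fact
  have "ancestors m R \<subseteq> V" "below R v \<subseteq> V" using subR below_subset by (auto simp: ancestors_def)
  then show "finite (ancestors m R)" "finite (below R v)" using finW by (meson finite_insert finite_subset)+
qed

lemma remove_connected:
  assumes "connected_on E X" "X \<subseteq> V" "X - {m} \<noteq> {}"
  shows "connected_on E (X - {m})"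
proof (rule connected_on_remove_simplicial[OF assms(1,3)])
  fix u w assume "u \<in> X - {m}" "w \<in> X - {m}" "u \<noteq> w" "(u, m) \<in> E" "(m, w) \<in> E"
  then show "(u, w) \<in> E" using simplicial[of u w] assms(2) symD[OF symE] by blast
qed

lemma connected_neighbour:
  assumes "connected_on E X" "m \<in> X" "v \<in> X" "v \<noteq> m"
  shows "\<exists>u \<in> X - {m}. (u, m) \<in> E"
proof (rule ccontr)
  assume n: "\<not> ?thesis"
  have "X \<subseteq> {m}"
    by (rule connected_on_induct[OF assms(1,2)]) (use n symD[OF symE] in blast)+
  then show False using assms by auto
qed

text \<open>Down-sets of vertices of \<open>W\<close> lose at most \<open>m\<close>, and removing a
  simplicial vertex keeps them connected.\<close>

lemma elim_order_project:
  assumes "elim_order E V R"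
  shows "elim_order E W (Restr R W)"
proof -
  interpret elim_order E V R by fact
  have b: "below (Restr R W) v = below R v - {m}" if "v \<in> W" for v
    using that below_subset[of v] m_notin by (auto simp del: mem_below) auto
  show ?thesis
  proof
    show "connected_on E (below (Restr R W) v)" if "v \<in> W" for v
    proof -
      have "v \<in> below R v - {m}" using that refl[of v] m_notin by auto
      then show ?thesis unfolding b[OF that]
        using remove_connected[OF conn below_subset, of v] that by blast
    qed
    show "(u, v) \<in> Restr R W \<or> (v, u) \<in> Restr R W" if "u \<in> W" "v \<in> W" "(u, v) \<in> E" for u v
      using that edge[of u v] by auto
  qed (use refl in \<open>auto intro: trans antisym dest: chain\<close>)
qed

lemma rot_order_project:
  assumes "rot_order E V i j R R'" "i \<in> W" "j \<in> W"
  shows "rot_order E W i j (Restr R W) (Restr R' W)"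
proof -
  have "below (Restr R W) v = (if v \<in> W then below R v \<inter> W else {})"
    "below (Restr R' W) v = (if v \<in> W then below R' v \<inter> W else {})" for v by auto
  then show ?thesis using assms elim_order_project by (auto simp: rot_order_def)
qed

text \<open>The down-set of \<open>m\<close> is connected because each \<open>S\<close>-down-set
  with a neighbour of \<open>m\<close> becomes connected once \<open>m\<close> is added, and all
  these enlarged sets share \<open>m\<close>.\<close>

lemma elim_order_ext_top:
  assumes "elim_order E W S"
  shows "elim_order E V (ext_top E m S)"
proof -
  interpret S: elim_order E W S by fact
  let ?R = "ext_top E m S"
  have m: "(m, w) \<notin> S" "(w, m) \<notin> S" for w using S.sub m_notin by auto
  have o: "(u, v) \<in> ?R \<longleftrightarrow> (u, v) \<in> S" if "v \<noteq> m" for u v using that by (auto simp: ext_top_def)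
  have t: "(w, m) \<in> ?R \<longleftrightarrow> w = m \<or> (\<exists>r u. (w, r) \<in> S \<and> (u, r) \<in> S \<and> (u, m) \<in> E)" for w
    using m by (auto simp: ext_top_def)
  have mo: "(m, w) \<in> ?R \<longleftrightarrow> w = m" for w using m by (auto simp: ext_top_def)
  \<comment> \<open>\<open>m\<close> stands above whole trees, so the vertices below it are closed
    under ancestors in \<open>S\<close>; this gives \<open>chain\<close> for pairs that involve
    \<open>m\<close>.\<close>
  have up: "(v, m) \<in> ?R" if um: "(u, m) \<in> ?R" and uv: "(u, v) \<in> S" for u v
  proof -
    obtain r w where rw: "(u, r) \<in> S" "(w, r) \<in> S" "(w, m) \<in> E" using um uv t[of u] m by metis
    from S.chain[OF uv rw(1)] show ?thesis
    proof
      assume "(v, r) \<in> S"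
      then show ?thesis using rw t by blast
    next
      assume "(r, v) \<in> S"
      then have "(w, v) \<in> S" "(v, v) \<in> S" using rw S.trans S.refl S.sub by blast+
      then show ?thesis using rw t by blast
    qed
  qed
  show ?thesis
  proof
    show "u \<in> V \<and> v \<in> V" if "(u, v) \<in> ?R" for u v using that S.sub by (auto simp: ext_top_def)
    show "(v, v) \<in> ?R" if "v \<in> V" for v using that S.refl by (auto simp: ext_top_def)
    show "(u, w) \<in> ?R" if uv: "(u, v) \<in> ?R" and vw: "(v, w) \<in> ?R" for u v w
    proof (cases "v = m \<or> w \<noteq> m")
      case True
      then show ?thesis using uv vw mo o S.trans m by metis
    next
      case False
      then have uvS: "(u, v) \<in> S" using uv o by auto
      obtain r a where r: "(v, r) \<in> S" "(a, r) \<in> S" "(a, m) \<in> E" using vw t[of v] False by auto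
      then have "(u, m) \<in> ?R" using S.trans[OF uvS r(1)] t[of u] by blast
      then show ?thesis using False by simp
    qed
    show "u = v" if "(u, v) \<in> ?R" "(v, u) \<in> ?R" for u v
      using that mo o S.antisym by metis
    show "(v, w) \<in> ?R \<or> (w, v) \<in> ?R" if "(u, v) \<in> ?R" "(u, w) \<in> ?R" for u v w
    proof -
      consider "v = m" "w = m" | "v = m" "w \<noteq> m" | "v \<noteq> m" "w = m" | "v \<noteq> m" "w \<noteq> m" by argo
      then show ?thesis
      proof cases
        case 1
        then show ?thesis using mo by simp
      next
        case 2
        then show ?thesis using up[of u w] that o[of w u] by simp
      next
        case 3
        then show ?thesis using up[of u v] that o[of v u] by simp
      next
        case 4
        then show ?thesis using S.chain[of u v w] that o[of v] o[of w] by blast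
      qed
    qed
    show "(u, v) \<in> ?R \<or> (v, u) \<in> ?R" if uv: "u \<in> V" "v \<in> V" "(u, v) \<in> E" for u v
    proof -
      have *: "(u, m) \<in> ?R" if "u \<in> V" "(u, m) \<in> E" for u using that S.refl t by blast
      show ?thesis using * uv symD[OF symE uv(3)] S.edge[of u v] o m_notin by (metis insertE)
    qed
    show "connected_on E (below ?R v)" if "v \<in> V" for v
    proof (cases "v = m")
      case False
      then have "below ?R v = below S v" using o by auto
      then show ?thesis using S.conn that False by auto
    next
      case True
      show ?thesis unfolding True
      proof (rule connected_on_UN[OF symE])
        show "m \<in> below ?R m" using t by auto
        fix x assume "x \<in> below ?R m"
        then consider "x = m" | r u where "(x, r) \<in> S" "(u, r) \<in> S" "(u, m) \<in> E" using t by auto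
        then show "\<exists>Y. connected_on E Y \<and> Y \<subseteq> below ?R m \<and> m \<in> Y \<and> x \<in> Y"
        proof cases
          case 1
          then show ?thesis using t connected_on_singleton[of E m] by (intro exI[of _ "{m}"]) auto
        next
          case 2
          have "connected_on E (insert m (below S r))"
            by (rule connected_on_insert[OF symE S.conn, of r u]) (use 2 S.sub in auto)
          then show ?thesis using 2 t by (intro exI[of _ "insert m (below S r)"]) auto
        qed
      qed
    qed
  qed
qed

text \<open>Here the clique condition is decisive: neighbours of \<open>m\<close> are pairwise
  comparable, so the vertices above any of them form a chain, as the ancestors of a leaf
  must.\<close>

lemma elim_order_ext_bot:
  assumes "elim_order E W S"
  shows "elim_order E V (ext_bot E m S)"
proof -
  interpret S: elim_order E W S by fact
  let ?R = "ext_bot E m S"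
  have m: "(m, w) \<notin> S" "(w, m) \<notin> S" for w using S.sub m_notin by auto
  have o: "(u, v) \<in> ?R \<longleftrightarrow> (u, v) \<in> S" if "u \<noteq> m" for u v using that by (auto simp: ext_bot_def)
  have t: "(m, v) \<in> ?R \<longleftrightarrow> v = m \<or> (\<exists>u. (u, v) \<in> S \<and> (u, m) \<in> E)" for v
    using m by (auto simp: ext_bot_def)
  have mo: "(w, m) \<in> ?R \<longleftrightarrow> w = m" for w using m by (auto simp: ext_bot_def)
  have ch: "(v, w) \<in> S \<or> (w, v) \<in> S" if "(a, v) \<in> S" "(a, m) \<in> E" "(b, w) \<in> S" "(b, m) \<in> E" for a b v w
  proof (cases "a = b")
    case True
    then show ?thesis using that S.chain by blast
  next
    case False
    then have "(a, b) \<in> S \<or> (b, a) \<in> S" using simplicial[of a b] that S.edge[of a b] S.sub by blast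
    then show ?thesis using that S.chain S.trans by blast
  qed
  show ?thesis
  proof
    show "u \<in> V \<and> v \<in> V" if "(u, v) \<in> ?R" for u v using that S.sub by (auto simp: ext_bot_def)
    show "(v, v) \<in> ?R" if "v \<in> V" for v using that S.refl by (auto simp: ext_bot_def)
    show "(u, w) \<in> ?R" if uv: "(u, v) \<in> ?R" and vw: "(v, w) \<in> ?R" for u v w
      using uv vw mo o t S.trans by metis
    show "u = v" if "(u, v) \<in> ?R" "(v, u) \<in> ?R" for u v
      using that mo o S.antisym by metis
    show "(v, w) \<in> ?R \<or> (w, v) \<in> ?R" if uv: "(u, v) \<in> ?R" and uw: "(u, w) \<in> ?R" for u v w
    proof (cases "u = m")
      case False
      then show ?thesis using uv uw o S.chain m by metis
    next
      case True
      then show ?thesis using uv uw ch t o m by metis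
    qed
    show "(u, v) \<in> ?R \<or> (v, u) \<in> ?R" if uv: "u \<in> V" "v \<in> V" "(u, v) \<in> E" for u v
    proof -
      have *: "(m, u) \<in> ?R" if "u \<in> V" "(u, m) \<in> E" for u using that S.refl t by blast
      show ?thesis using * uv symD[OF symE uv(3)] S.edge[of u v] o m_notin by (metis insertE)
    qed
    show "connected_on E (below ?R v)" if v: "v \<in> V" for v
    proof -
      have ?thesis if "v \<noteq> m" "(m, v) \<notin> ?R"
      proof -
        have "below ?R v = below S v" using that o m by (auto simp: ext_bot_def)
        then show ?thesis using S.conn v that by auto
      qed
      moreover have ?thesis if "v \<noteq> m" and mv: "(m, v) \<in> ?R"
      proof -
        obtain u where u: "(u, v) \<in> S" "(u, m) \<in> E" using t[of v] mv \<open>v \<noteq> m\<close> by auto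
        have "below ?R v = insert m (below S v)" using \<open>v \<noteq> m\<close> mv by (auto simp: ext_bot_def)
        then show ?thesis using connected_on_insert[OF symE S.conn, of v u m] u v \<open>v \<noteq> m\<close> by auto
      qed
      moreover have ?thesis if "v = m"
      proof -
        have "below ?R v = {m}" unfolding below_def that mo by simp
        then show ?thesis using connected_on_singleton by simp
      qed
      ultimately show ?thesis by (cases "v = m"; cases "(m, v) \<in> ?R") simp_all
    qed
  qed
qed

lemma project_ext:
  assumes "elim_order E W S"
  shows "Restr (ext_top E m S) W = S" "Restr (ext_bot E m S) W = S"
proof -
  interpret S: elim_order E W S by fact
  show "Restr (ext_top E m S) W = S" "Restr (ext_bot E m S) W = S"
    using S.sub m_notin by (auto simp: ext_top_def ext_bot_def)
qed

text \<open>Only the down-set of \<open>m\<close> is not copied from \<open>S\<close>. It consists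
  of \<open>m\<close> and whole trees, and a rotation preserves the vertex set of a tree: a common
  ancestor \<open>r\<close> among \<open>i\<close> and \<open>j\<close> may be replaced by
  \<open>i\<close>, whose down-set reappears as that of \<open>j\<close>.\<close>

lemma rot_order_ext_top:
  assumes "rot_order E W i j S S'"
  shows "rot_order E V i j (ext_top E m S) (ext_top E m S')"
proof -
  interpret S: elim_order E W S using assms by (simp add: rot_order_def)
  interpret S': elim_order E W S' using assms by (simp add: rot_order_def)
  have b: "below S' j = below S i" "\<And>v. v \<noteq> i \<Longrightarrow> v \<noteq> j \<Longrightarrow> below S' v = below S v"
    and ij: "(j, i) \<in> S" "i \<noteq> j" using assms by (auto simp: rot_order_def)
  have ij': "(i, j) \<in> S'" using rot_order_sym[OF assms] by (auto simp: rot_order_def)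
  have ne: "i \<noteq> m" "j \<noteq> m" using ij S.sub m_notin by blast+
  have sub: "\<exists>r u. (w, r) \<in> T' \<and> (u, r) \<in> T' \<and> (u, m) \<in> E"
    if T: "rot_order E W i j T T'" and wr: "(w, r) \<in> T" "(u, r) \<in> T" "(u, m) \<in> E" for T T' i j w r u
  proof -
    interpret T: elim_order E W T using T by (simp add: rot_order_def)
    have b: "below T' j = below T i" "\<And>v. v \<noteq> i \<Longrightarrow> v \<noteq> j \<Longrightarrow> below T' v = below T v"
      and ij: "(j, i) \<in> T" using T by (auto simp: rot_order_def)
    consider "r = i \<or> r = j" | "r \<noteq> i" "r \<noteq> j" by blast
    then show ?thesis
    proof cases
      case 1
      then have "(w, i) \<in> T" "(u, i) \<in> T" using wr T.trans ij by blast+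
      then show ?thesis using b(1) wr(3) by (auto simp: set_eq_iff)
    next
      case 2
      then show ?thesis using b(2)[of r] wr by (auto simp: set_eq_iff)
    qed
  qed
  have o: "below (ext_top E m T) v = below T v" if "v \<noteq> m" for v T
    using that by (auto simp: ext_top_def)
  have t: "below (ext_top E m T) m = insert m {w. \<exists>r u. (w, r) \<in> T \<and> (u, r) \<in> T \<and> (u, m) \<in> E}"
    if "elim_order E W T" for T
    using elim_order.subR[OF that] m_notin by (auto simp: ext_top_def)
  have "below (ext_top E m S') m = below (ext_top E m S) m"
    unfolding t[OF S.elim_order_axioms] t[OF S'.elim_order_axioms]
    using sub[OF assms] sub[OF rot_order_sym[OF assms]] by blast
  then have "below (ext_top E m S') v = below (ext_top E m S) v" if "v \<noteq> i" "v \<noteq> j" for v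
    using b(2) that o by (cases "v = m") auto
  moreover have "(j, i) \<in> ext_top E m S" using ij by (simp add: ext_top_def)
  moreover have "below (ext_top E m S') j = below (ext_top E m S) i" using b(1) o ne by simp
  ultimately show ?thesis unfolding rot_order_def
    using elim_order_ext_top[OF S.elim_order_axioms] elim_order_ext_top[OF S'.elim_order_axioms] ij
    by blast
qed

text \<open>Whether \<open>m\<close> joins the down-set of another vertex depends on that down-set
  alone, so equal down-sets stay equal.\<close>

lemma rot_order_ext_bot:
  assumes "rot_order E W i j S S'"
  shows "rot_order E V i j (ext_bot E m S) (ext_bot E m S')"
proof -
  interpret S: elim_order E W S using assms by (simp add: rot_order_def)
  interpret S': elim_order E W S' using assms by (simp add: rot_order_def)
  have b: "below S' j = below S i" "\<And>v. v \<noteq> i \<Longrightarrow> v \<noteq> j \<Longrightarrow> below S' v = below S v"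
    and ij: "(j, i) \<in> S" "i \<noteq> j" using assms by (auto simp: rot_order_def)
  have ne: "i \<noteq> m" "j \<noteq> m" using ij S.sub m_notin by blast+
  have o: "below (ext_bot E m T) v = below T v \<union> (if v = m \<or> (\<exists>u\<in>below T v. (u, m) \<in> E) then {m} else {})"
    for v T by (auto simp: ext_bot_def)
  have "below (ext_bot E m S') j = below (ext_bot E m S) i" unfolding o b(1) using ne by simp
  moreover have "below (ext_bot E m S') v = below (ext_bot E m S) v" if "v \<noteq> i" "v \<noteq> j" for v
    unfolding o b(2)[OF that] by simp
  moreover have "(j, i) \<in> ext_bot E m S" using ij by (simp add: ext_bot_def)
  ultimately show ?thesis unfolding rot_order_def
    using elim_order_ext_bot[OF S.elim_order_axioms] elim_order_ext_bot[OF S'.elim_order_axioms] ij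
    by blast
qed

text \<open>A connected down-set with \<open>m\<close> and a further vertex contains a neighbour of
  \<open>m\<close>. Hence \<open>ext_bot\<close> is the deepest position in the fibre.\<close>

lemma ancestors_ext_bot:
  assumes "elim_order E V R"
  shows "ancestors m R \<subseteq> ancestors m (ext_bot E m (Restr R W))"
proof
  interpret elim_order E V R by fact
  fix v assume "v \<in> ancestors m R"
  then have v: "(m, v) \<in> R" "v \<noteq> m" by (auto simp: ancestors_def)
  then have vV: "v \<in> V" using sub by auto
  have "\<exists>u \<in> below R v - {m}. (u, m) \<in> E"
    using connected_neighbour[OF conn[OF vV], of v] v refl[OF vV] by simp
  then obtain u where "u \<in> below R v - {m}" "(u, m) \<in> E" ..
  then show "v \<in> ancestors m (ext_bot E m (Restr R W))"
    using v subL[of _ v] vV by (auto simp: ancestors_def ext_bot_def)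
qed

end

text \<open>Among the strict descendants, one with the fewest ancestors has nothing between itself
  and \<open>x\<close>. The dual lemma \<open>parent_exists\<close> takes a strict ancestor with the
  smallest down-set.\<close>

lemma (in elim_order) child_exists:
  assumes "finite V" "(w, x) \<in> R" "w \<noteq> x"
  shows "\<exists>i. covers R x i"
proof -
  let ?P = "\<lambda>i. (i, x) \<in> R \<and> i \<noteq> x" and ?A = "\<lambda>i. {v. (i, v) \<in> R}"
  have fin: "finite (?A i)" for i by (rule finite_subset[OF _ assms(1)]) (auto dest: subR)
  have "?P w" using assms by simp
  then obtain i where i: "?P i" and least: "\<And>y. ?P y \<Longrightarrow> card (?A i) \<le> card (?A y)"
    using ex_has_least_nat[of ?P w "\<lambda>i. card (?A i)"] by blast
  have "v = x \<or> v = i" if v: "(i, v) \<in> R" "(v, x) \<in> R" for v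
  proof (rule ccontr)
    assume n: "\<not> ?thesis"
    have "?A v \<subseteq> ?A i" using trans[OF v(1)] by blast
    moreover have "i \<notin> ?A v" using antisym[OF v(1)] n by blast
    moreover have "i \<in> ?A i" using refl[OF subL[OF v(1)]] by simp
    ultimately have "?A v \<subset> ?A i" by blast
    then show False using psubset_card_mono[OF fin] least[of v] v n by (meson leD)
  qed
  then show ?thesis using i unfolding covers_def by metis
qed

lemma (in elim_order) parent_exists:
  assumes "finite V" "(x, w) \<in> R" "w \<noteq> x"
  shows "\<exists>i. covers R i x"
proof -
  let ?P = "\<lambda>i. (x, i) \<in> R \<and> i \<noteq> x"
  have fin: "finite (below R i)" for i by (rule finite_subset[OF below_subset assms(1)])
  have "?P w" using assms by simp
  then obtain i where i: "?P i" and least: "\<And>y. ?P y \<Longrightarrow> card (below R i) \<le> card (below R y)"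
    using ex_has_least_nat[of ?P w "\<lambda>i. card (below R i)"] by blast
  have "v = i \<or> v = x" if v: "(x, v) \<in> R" "(v, i) \<in> R" for v
  proof (rule ccontr)
    assume n: "\<not> ?thesis"
    have "below R v \<subseteq> below R i" using trans[OF _ v(2)] by auto
    moreover have "i \<notin> below R v" using antisym[OF v(2)] n by auto
    moreover have "i \<in> below R i" using refl[OF subR[OF v(2)]] by simp
    ultimately have "below R v \<subset> below R i" by blast
    then show False using psubset_card_mono[OF fin] least[of v] v n by (meson leD)
  qed
  then show ?thesis using i unfolding covers_def by metis
qed

context simplicial_extension
begin

section \<open>The fibre over an order of the smaller graph\<close>

lemma finV: "finite V"
  using finW by simp

text \<open>Deleting the simplicial vertex \<open>m\<close> leaves the rest of its subtree
  connected, so it cannot split into several child subtrees. Thus \<open>m\<close> has at most one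
  child, and its rotations run along a path.\<close>

lemma below_only_child:
  assumes "elim_order E V R" "covers R m i"
  shows "below R i = below R m - {m}"
proof
  interpret elim_order E V R by fact
  have i: "i \<noteq> m" "(i, m) \<in> R" "\<And>w. (i, w) \<in> R \<Longrightarrow> (w, m) \<in> R \<Longrightarrow> w = m \<or> w = i"
    using assms(2) unfolding covers_def by metis+
  show "below R i \<subseteq> below R m - {m}" using i trans[OF _ i(2)] antisym[OF i(2)] by auto
  show "below R m - {m} \<subseteq> below R i"
  proof (rule connected_on_induct)
    have im: "i \<in> below R m - {m}" using i by simp
    then show "connected_on E (below R m - {m})"
      using remove_connected[OF conn below_subset, of m] by blast
    show "i \<in> below R m - {m}" by fact
    show "i \<in> below R i" using refl[OF subL[OF i(2)]] by simp
    fix u w assume u: "u \<in> below R i" and w: "w \<in> below R m - {m}" and e: "(u, w) \<in> E"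
    have "(w, i) \<in> R"
    proof -
      have uV: "u \<in> V" and wV: "w \<in> V" using u w subL by auto
      consider "(w, u) \<in> R" | "(u, w) \<in> R" using edge[OF uV wV e] by blast
      then show ?thesis
      proof cases
        case 1
        then show ?thesis using trans u by auto
      next
        case 2
        then have "(w, i) \<in> R \<or> (i, w) \<in> R" using chain[OF 2, of i] u by simp
        then show ?thesis using i(3)[of w] w refl[OF wV] by auto
      qed
    qed
    then show "w \<in> below R i" by simp
  qed
qed

text \<open>The only child \<open>i\<close> takes over the down-set of \<open>m\<close>, which
  exceeds its own just by \<open>m\<close>. So nothing changes on \<open>W\<close>, and the depth of
  \<open>m\<close> grows by one.\<close>

lemma rot_max:
  assumes "rot_order E V m i R R'"
  shows "Restr R' W = Restr R W" "ancestors m R' = insert i (ancestors m R)" "i \<notin> ancestors m R"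
proof -
  interpret elim_order E V R using assms by (simp add: rot_order_def)
  have im: "(i, m) \<in> R" "i \<noteq> m" using assms by (auto simp: rot_order_def)
  have i: "below R' i = below R m" and o: "\<And>v. v \<noteq> m \<Longrightarrow> v \<noteq> i \<Longrightarrow> below R' v = below R v"
    using assms by (auto simp: rot_order_def)
  have bi: "below R i = below R m - {m}"
    using below_only_child[OF elim_order_axioms rot_order_covers[OF assms]] .
  have "below R' v \<inter> W = below R v \<inter> W" if "v \<in> W" for v
  proof (cases "v = i")
    case True
    then show ?thesis using i bi m_notin by blast
  next
    case False
    then show ?thesis using o[of v] that m_notin by (cases "v = m") auto
  qed
  then show "Restr R' W = Restr R W" unfolding below_def by blast
  have "(m, i) \<in> R'" using i refl[of m] unfolding below_def by blast
  moreover have "(m, v) \<in> R' \<longleftrightarrow> (m, v) \<in> R" if "v \<noteq> m" "v \<noteq> i" for v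
    using o[OF that] unfolding below_def by blast
  moreover show "i \<notin> ancestors m R" using im antisym[of i m] by (auto simp: ancestors_def)
  ultimately show "ancestors m R' = insert i (ancestors m R)" using im by (auto simp: ancestors_def)
qed

text \<open>The subtree of \<open>w\<close> in \<open>R'\<close> contains a neighbour
  \<open>u\<close> of \<open>m\<close>. In \<open>R\<close>, too, \<open>u\<close> is below
  \<open>w\<close>, and it is comparable with \<open>m\<close>; if \<open>m\<close> were below
  \<open>u\<close>, it would be below \<open>w\<close>. So \<open>u\<close> is below both
  \<open>m\<close> and \<open>w\<close>, which makes these comparable.\<close>

lemma fibre_ancestors:
  assumes "elim_order E V R" "elim_order E V R'" "Restr R W = Restr R' W"
    and "w \<in> ancestors m R'" "w \<notin> ancestors m R"
  shows "(w, m) \<in> R"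
proof -
  interpret R: elim_order E V R by fact
  interpret R': elim_order E V R' by fact
  have w: "w \<noteq> m" "(m, w) \<in> R'" "(m, w) \<notin> R" using assms(4,5) by (auto simp: ancestors_def)
  have wV: "w \<in> V" using R'.subR w by blast
  have "\<exists>u \<in> below R' w - {m}. (u, m) \<in> E"
    using connected_neighbour[OF R'.conn[OF wV], of w] w R'.refl[OF wV] by simp
  then obtain u where u: "u \<in> below R' w - {m}" "(u, m) \<in> E" ..
  have uW: "u \<in> W" using u R'.subL[of u w] by auto
  then have "(u, w) \<in> Restr R' W" using u w wV by auto
  then have uw: "(u, w) \<in> R" using assms(3) by blast
  have "(m, u) \<notin> R" using uw w(3) R.trans by blast
  then have "(u, m) \<in> R" using R.edge[of u m] u(2) uW by blast
  then show ?thesis using R.chain[OF _ uw] w(3) by blast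
qed

text \<open>If \<open>a\<close> and \<open>b\<close> were ancestors in one order only,
  \<open>m\<close> would separate them in opposite directions in \<open>R\<close> and
  \<open>R'\<close>, although the two agree on \<open>W\<close>.\<close>

lemma fibre_linear:
  assumes "elim_order E V R" "elim_order E V R'" "Restr R W = Restr R' W"
  shows "ancestors m R \<subseteq> ancestors m R' \<or> ancestors m R' \<subseteq> ancestors m R"
proof (rule ccontr)
  interpret R: elim_order E V R by fact
  interpret R': elim_order E V R' by fact
  assume "\<not> ?thesis"
  then obtain a b where a: "a \<in> ancestors m R" "a \<notin> ancestors m R'" and b: "b \<in> ancestors m R'" "b \<notin> ancestors m R" by blast
  have "(b, m) \<in> R" "(a, m) \<in> R'"
    using fibre_ancestors[OF assms b] fibre_ancestors[OF assms(2,1) assms(3)[symmetric] a] by auto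
  then have ba: "(b, a) \<in> R" "(a, b) \<in> R'" using a b R.trans R'.trans unfolding ancestors_def by blast+
  moreover have "a \<in> W" "b \<in> W" using R.sub[OF ba(1)] a b unfolding ancestors_def by auto
  ultimately have "(a, b) \<in> R" using assms(3) by blast
  then have "a = b" using R.antisym ba(1) by blast
  then show False using a b by blast
qed

text \<open>The restriction gives the pairs inside \<open>W\<close>, the ancestors those starting at
  \<open>m\<close>. The down-set of \<open>m\<close> is recovered by growing it along edges: a
  vertex reached is comparable with \<open>m\<close> and not an ancestor, hence below.\<close>

lemma fibre_inj:
  assumes "elim_order E V R" "elim_order E V R'" "Restr R W = Restr R' W" "ancestors m R = ancestors m R'"
  shows "R = R'"
proof (rule below_eqI)
  have m: "below R m \<subseteq> below R' m"
    if "elim_order E V R" "elim_order E V R'" "ancestors m R = ancestors m R'" for R R'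
  proof -
    interpret R: elim_order E V R by fact
    interpret R': elim_order E V R' by fact
    show ?thesis
    proof (rule connected_on_induct[OF R.conn])
      show "m \<in> V" "m \<in> below R m" "m \<in> below R' m" using R.refl R'.refl by auto
      fix u w assume u: "u \<in> below R' m" and w: "w \<in> below R m" and e: "(u, w) \<in> E"
      have V: "u \<in> V" "w \<in> V" using u w R'.subL[of u m] R.subL[of w m] by simp_all
      consider "(w, u) \<in> R'" | "(u, w) \<in> R'" using R'.edge[OF V e] by blast
      then have "(w, m) \<in> R' \<or> (m, w) \<in> R'"
        using R'.trans[of w u m] R'.chain[of u w m] u by (cases) simp_all
      moreover have "w = m" if "(m, w) \<in> R'"
      proof (rule ccontr)
        assume "w \<noteq> m"
        then have "w \<in> ancestors m R" using that \<open>ancestors m R = ancestors m R'\<close> by (simp add: ancestors_def)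
        then have "(m, w) \<in> R" by (simp add: ancestors_def)
        then show False using R.antisym[of m w] w \<open>w \<noteq> m\<close> by simp
      qed
      ultimately show "w \<in> below R' m" using R'.refl[of m] by auto
    qed
  qed
  interpret R: elim_order E V R by fact
  interpret R': elim_order E V R' by fact
  fix v
  show "below R v = below R' v"
  proof (cases "v = m")
    case True
    then show ?thesis using m[OF assms(1,2,4)] m[OF assms(2,1) assms(4)[symmetric]] by blast
  next
    case False
    have "(u, v) \<in> R \<longleftrightarrow> (u, v) \<in> R'" for u
    proof (cases "u = m")
      case True
      then show ?thesis using assms(4) False unfolding ancestors_def by blast
    next
      case u: False
      show ?thesis using assms(3) R.sub[of u v] R'.sub[of u v] u False by blast
    qed
    then show ?thesis by auto
  qed
qed

lemma fibre_inj_card: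
  assumes "elim_order E V R" "elim_order E V R'" "Restr R W = Restr R' W"
    "card (ancestors m R) = card (ancestors m R')"
  shows "R = R'"
  using fibre_linear[OF assms(1-3)] fibre_inj[OF assms(1-3)] assms(4)
    card_subset_eq[OF elim_order_finite(1)[OF assms(1)]] card_subset_eq[OF elim_order_finite(1)[OF assms(2)]]
  by metis

text \<open>Positions count ancestors, so ascending moves \<open>m\<close> down the tree. An
  ancestor of \<open>m\<close> in \<open>R'\<close> that is missing in \<open>R\<close> lies below
  \<open>m\<close> in \<open>R\<close>, so \<open>m\<close> has a child that can be rotated above
  it.\<close>

lemma fibre_ascend:
  assumes "elim_order E V R" "elim_order E V R'" "Restr R W = Restr R' W"
    "card (ancestors m R) < card (ancestors m R')"
  shows "\<exists>i R''. i < m \<and> rot_order E V m i R R''"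
proof -
  interpret R: elim_order E V R by fact
  have "\<not> ancestors m R' \<subseteq> ancestors m R"
    using assms(4) card_mono[OF elim_order_finite(1)[OF assms(1)]] by (meson leD)
  then obtain w where w: "w \<in> ancestors m R'" "w \<notin> ancestors m R" by blast
  then have "(w, m) \<in> R" "w \<noteq> m" using fibre_ancestors[OF assms(1-3) w] by (auto simp: ancestors_def)
  then obtain i where i: "covers R m i" using R.child_exists[OF finV] by blast
  then have "i < m" using R.subL[of i m] less_m by (auto simp: covers_def)
  then show ?thesis using rot_order_exists[OF symE assms(1) i] by blast
qed

lemma fibre_descend:
  assumes "elim_order E V R" "ancestors m R \<noteq> {}"
  shows "\<exists>i R''. i < m \<and> rot_order E V i m R R''"
proof -
  interpret R: elim_order E V R by fact
  obtain w where "(m, w) \<in> R" "w \<noteq> m" using assms(2) by (auto simp: ancestors_def)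
  then obtain i where i: "covers R i m" using R.parent_exists[OF finV] by blast
  then have "i < m" using R.subR[of m i] less_m by (auto simp: covers_def)
  then show ?thesis using rot_order_exists[OF symE assms(1) i] by blast
qed

lemma move_max:
  assumes "move E V m i R R'"
  shows "Restr R' W = Restr R W"
    "(ancestors m R' = insert i (ancestors m R) \<and> i \<notin> ancestors m R) \<or>
     (ancestors m R = insert i (ancestors m R') \<and> i \<notin> ancestors m R')"
    "finite (ancestors m R)" "finite (ancestors m R')"
proof -
  consider "rot_order E V m i R R'" | "rot_order E V m i R' R"
    using assms rot_order_sym unfolding move_def by blast
  note c = this
  show "Restr R' W = Restr R W" using c by cases (use rot_max(1) in auto)
  show "(ancestors m R' = insert i (ancestors m R) \<and> i \<notin> ancestors m R) \<or>
     (ancestors m R = insert i (ancestors m R') \<and> i \<notin> ancestors m R')"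
    using c by cases (use rot_max(2,3) in blast)+
  show "finite (ancestors m R)" "finite (ancestors m R')"
    using c elim_order_finite(1) unfolding rot_order_def by blast+
qed

text \<open>By antisymmetry only one direction of rotation applies to a given pair, and its result
  is unique.\<close>

lemma move_det: "move E V j i R R' \<Longrightarrow> move E V j i R R'' \<Longrightarrow> R' = R''"
  unfolding move_def
  by (metis elim_order.antisym nat_neq_iff rot_order_def rot_order_unique)

text \<open>Fibres are those of restriction to \<open>W\<close>, and the position is the depth of
  \<open>m\<close>: zero at \<open>ext_top\<close>, maximal at \<open>ext_bot\<close>. The ancestor
  sets before and after a rotation of \<open>m\<close> differ exactly in \<open>i\<close>, so the
  two states determine the label.\<close>

sublocale zigzag "move E V" "move E W" "{R. elim_order E V R}" "{S. elim_order E W S}"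
  "\<lambda>R. Restr R W" "\<lambda>R. int (card (ancestors m R))" "ext_top E m" "ext_bot E m" m
proof
  fix j i R R' assume mv: "move E V j i R R'"
  then have el: "elim_order E V R" "elim_order E V R'" and "(j, i) \<in> R \<or> (i, j) \<in> R" and ij: "i < j"
    by (auto simp: move_def rot_order_def)
  then have V: "i \<in> V" "j \<in> V" using elim_order.sub by blast+
  then show "R \<in> {R. elim_order E V R} \<and> R' \<in> {R. elim_order E V R} \<and> j \<le> m"
    using el less_m by (auto intro: less_imp_le)
  assume "j \<noteq> m"
  then have "j \<in> W" "i \<in> W" using V ij less_m[of j] by auto
  then show "move E W j i (Restr R W) (Restr R' W)"
    using mv rot_order_project unfolding move_def by blast
next
  fix j i S S' assume mv: "move E W j i S S'"
  then show "S \<in> {S. elim_order E W S} \<and> S' \<in> {S. elim_order E W S}"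
    by (auto simp: move_def rot_order_def)
  show "move E V j i (ext_top E m S) (ext_top E m S')" "move E V j i (ext_bot E m S) (ext_bot E m S')"
    using mv rot_order_ext_top rot_order_ext_bot unfolding move_def by blast+
next
  fix i R R' assume mv: "move E V m i R R'"
  have "card (ancestors m R') = card (ancestors m R) + 1 \<or> card (ancestors m R) = card (ancestors m R') + 1"
    using move_max(2-4)[OF mv] by auto
  then show "Restr R' W = Restr R W \<and> (int (card (ancestors m R')) = int (card (ancestors m R)) + 1 \<or>
      int (card (ancestors m R')) = int (card (ancestors m R)) - 1)"
    using move_max(1)[OF mv] by linarith
  fix i' assume "move E V m i' R R'"
  then show "i = i'" using move_max(2)[OF mv] move_max(2)[of i' R R'] by blast
next
  show "R' = R''" if "move E V j i R R'" "move E V j i R R''" for j i R R' R''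
    using move_det that by blast
next
  fix R R' assume "R \<in> {R. elim_order E V R}" "R' \<in> {R. elim_order E V R}" "Restr R W = Restr R' W"
  note R = this[simplified]
  show "R = R'" if "int (card (ancestors m R)) = int (card (ancestors m R'))"
    using fibre_inj_card R that by simp
  show "\<exists>i R''. move E V m i R R'' \<and> int (card (ancestors m R'')) = int (card (ancestors m R)) + 1"
    if lt: "int (card (ancestors m R)) < int (card (ancestors m R'))"
  proof -
    obtain i R'' where i: "i < m" "rot_order E V m i R R''" using fibre_ascend[of R R'] R lt by auto
    then have "card (ancestors m R'') = card (ancestors m R) + 1"
      using rot_max[OF i(2)] elim_order_finite(1)[of R] R by simp
    then show ?thesis using i unfolding move_def by (metis of_nat_1 of_nat_add)
  qed
  show "\<exists>i R''. move E V m i R R'' \<and> int (card (ancestors m R'')) = int (card (ancestors m R)) - 1"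
    if lt: "int (card (ancestors m R')) < int (card (ancestors m R))"
  proof -
    obtain i R'' where i: "i < m" "rot_order E V i m R R''" using fibre_descend[of R] R lt by fastforce
    note r = rot_order_sym[OF i(2)]
    have "finite (ancestors m R'')" using r elim_order_finite(1) unfolding rot_order_def by blast
    then have "card (ancestors m R) = card (ancestors m R'') + 1" using rot_max[OF r] by simp
    then show ?thesis using i unfolding move_def by (intro exI[of _ i] exI[of _ R'']) simp
  qed
next
  fix S assume "S \<in> {S. elim_order E W S}"
  then have S: "elim_order E W S" by simp
  show "ext_top E m S \<in> {R. elim_order E V R} \<and> Restr (ext_top E m S) W = S"
    using elim_order_ext_top[OF S] project_ext(1)[OF S] by simp
  show "ext_bot E m S \<in> {R. elim_order E V R} \<and> Restr (ext_bot E m S) W = S"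
    using elim_order_ext_bot[OF S] project_ext(2)[OF S] by simp
next
  fix R assume "R \<in> {R. elim_order E V R}"
  then have R: "elim_order E V R" by simp
  have "ancestors m (ext_top E m (Restr R W)) = {}"
    using m_notin by (auto simp: ancestors_def ext_top_def)
  moreover have "card (ancestors m R) \<le> card (ancestors m (ext_bot E m (Restr R W)))"
    using card_mono[OF elim_order_finite(1)[OF elim_order_ext_bot[OF elim_order_project[OF R]]] ancestors_ext_bot[OF R]] .
  ultimately show "int (card (ancestors m (ext_top E m (Restr R W)))) \<le> int (card (ancestors m R)) \<and>
      int (card (ancestors m R)) \<le> int (card (ancestors m (ext_bot E m (Restr R W))))" by simp
qed

end

text \<open>The order-theoretic trace of removing vertices by increasing number: ancestors are
  removed earlier.\<close>

definition decreasing :: "nat rel \<Rightarrow> bool" where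
  "decreasing R \<longleftrightarrow> (\<forall>(u, v) \<in> R. v \<le> u)"

text \<open>Down-sets are compared by growing along edges: a vertex \<open>w\<close> of
  \<open>below R v\<close> has \<open>v \<le> w\<close> and turns out comparable with
  \<open>v\<close> in \<open>R'\<close>, where a place above \<open>v\<close> would force
  \<open>w \<le> v\<close>. This later identifies the abstract start order with the initial
  forest.\<close>

lemma decreasing_unique:
  assumes "elim_order E V R" "elim_order E V R'" "decreasing R" "decreasing R'"
  shows "R = R'"
proof -
  have *: "R \<subseteq> R'" if "elim_order E V R" "elim_order E V R'" "decreasing R" "decreasing R'" for R R'
  proof -
    interpret R: elim_order E V R by fact
    interpret R': elim_order E V R' by fact
    have "below R v \<subseteq> below R' v" if vV: "v \<in> V" for v
    proof (rule connected_on_induct[OF R.conn[OF vV]])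
      show "v \<in> below R v" "v \<in> below R' v" using R.refl[OF vV] R'.refl[OF vV] by auto
      fix u w assume u: "u \<in> below R' v" and w: "w \<in> below R v" and e: "(u, w) \<in> E"
      have V: "u \<in> V" "w \<in> V" using u w R'.subL[of u v] R.subL[of w v] by simp_all
      have "v \<le> w" using w \<open>decreasing R\<close> by (auto simp: decreasing_def)
      consider "(w, u) \<in> R'" | "(u, w) \<in> R'" using R'.edge[OF V e] by blast
      then have "(w, v) \<in> R' \<or> (v, w) \<in> R'"
        using R'.trans[of w u v] R'.chain[of u w v] u by cases simp_all
      moreover have "w = v" if "(v, w) \<in> R'"
        using that \<open>v \<le> w\<close> \<open>decreasing R'\<close> by (auto simp: decreasing_def)
      ultimately show "w \<in> below R' v" using R'.refl[OF vV] by auto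
    qed
    then show ?thesis using R.subR by fastforce
  qed
  show ?thesis using *[OF assms] *[OF assms(2,1,4,3)] by blast
qed

text \<open>\<open>greedy_lift\<close> starts at \<open>ext_bot\<close>, which puts the new largest
  vertex only below others and so keeps the start order decreasing.\<close>

lemma greedy_orders:
  assumes "sym E" "perfect_elimination_ordering n E" "k \<le> n"
  shows "\<exists>R0 Rs. elim_order E {1..k} R0 \<and> decreasing R0 \<and> greedy (move E {1..k}) R0 Rs \<and>
    set Rs = {R. elim_order E {1..k} R}"
  using assms(3)
proof (induction k)
  case 0
  have "elim_order E {1..0} R \<longleftrightarrow> R = {}" for R :: "nat rel"
    by (auto simp: elim_order_def)
  then show ?case
    by (intro exI[of _ "{}"] exI[of _ "[{}]"]) (auto simp: decreasing_def greedy_start)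
next
  case (Suc k)
  then obtain S0 Ss where S: "elim_order E {1..k} S0" "decreasing S0" "greedy (move E {1..k}) S0 Ss"
    "set Ss = {S. elim_order E {1..k} S}" by auto
  interpret simplicial_extension E "{1..k}" "Suc k"
  proof
    have cl: "clique E (insert (Suc k) {u. (u, Suc k) \<in> E \<and> u < Suc k})"
      using assms(2) Suc.prems by (auto simp: perfect_elimination_ordering_def)
    show "(u, w) \<in> E" if "u \<in> {1..k}" "w \<in> {1..k}" "u \<noteq> w" "(u, Suc k) \<in> E" "(w, Suc k) \<in> E" for u w
      using cl that unfolding clique_def by auto
  qed (use assms(1) in auto)
  have V: "{1..Suc k} = V" by auto
  obtain Rs where Rs: "greedy (move E V) (ext_bot E (Suc k) S0) Rs"
    "set Rs = {R \<in> {R. elim_order E V R}. Restr R {1..k} \<in> set Ss}"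
    using greedy_lift[OF S(3)] S(1) by blast
  have "set Rs = {R. elim_order E V R}" using Rs(2) S(4) elim_order_project by auto
  moreover have "decreasing (ext_bot E (Suc k) S0)"
    using S(2) by (auto simp: decreasing_def ext_bot_def dest: elim_order.subR[OF S(1)])
  ultimately show ?case using Rs(1) elim_order_ext_bot[OF S(1)] unfolding V by blast
qed

section \<open>Trees and their orders\<close>

text \<open>The recursive calls pass through the image operator of \<open>fset\<close>, as primitive
  recursion over the nested datatype demands; \<open>tree_order_Node\<close> is the usable equation,
  and \<open>wf_tree_Node\<close> plays this part for \<open>wf_tree\<close>.\<close>

primrec tree_order :: "nat rtree \<Rightarrow> nat rel" where
  "tree_order (Node x C) = verts (Node x C) \<times> {x} \<union> \<Union>(fset (tree_order |`| C))"

definition forest_order :: "forest \<Rightarrow> nat rel" where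
  "forest_order F = (\<Union>T\<in>F. tree_order T)"

definition disjoint_trees :: "forest \<Rightarrow> bool" where
  "disjoint_trees F \<longleftrightarrow> (\<forall>S\<in>F. \<forall>T\<in>F. S \<noteq> T \<longrightarrow> verts S \<inter> verts T = {})"

primrec wf_tree :: "nat rtree \<Rightarrow> bool" where
  "wf_tree (Node x C) \<longleftrightarrow> x \<notin> \<Union>(verts ` fset C) \<and> disjoint_trees (fset C) \<and>
     (\<forall>b \<in> fset (wf_tree |`| C). b)"

definition wf_forest :: "forest \<Rightarrow> bool" where
  "wf_forest F \<longleftrightarrow> (\<forall>T\<in>F. wf_tree T) \<and> disjoint_trees F"

lemma wf_tree_Node: "wf_tree (Node x C) \<longleftrightarrow> x \<notin> \<Union>(verts ` fset C) \<and> wf_forest (fset C)"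
  by (auto simp: wf_forest_def)

lemma tree_order_Node:
  "tree_order (Node x C) = verts (Node x C) \<times> {x} \<union> forest_order (fset C)"
  by (simp add: forest_order_def)

declare wf_tree.simps [simp del] tree_order.simps [simp del]

lemma verts_Node: "verts (Node x C) = insert x (\<Union>(verts ` fset C))"
  by simp

lemma verts_nonempty: "verts T \<noteq> {}"
  by (cases T) simp

lemma tree_order_subset: "tree_order T \<subseteq> verts T \<times> verts T"
proof (induction T)
  case (Node x C)
  then show ?case unfolding tree_order_Node forest_order_def by fastforce
qed

lemma disjoint_treesD: "disjoint_trees F \<Longrightarrow> S \<in> F \<Longrightarrow> T \<in> F \<Longrightarrow> u \<in> verts S \<Longrightarrow> u \<in> verts T \<Longrightarrow> S = T"
  unfolding disjoint_trees_def by blast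

lemma forest_order_tree:
  assumes "disjoint_trees F" "T \<in> F" "(u, v) \<in> forest_order F" "u \<in> verts T \<or> v \<in> verts T"
  shows "(u, v) \<in> tree_order T"
proof -
  obtain S where S: "S \<in> F" "(u, v) \<in> tree_order S" using assms(3) by (auto simp: forest_order_def)
  then have "u \<in> verts S" "v \<in> verts S" using tree_order_subset by blast+
  then have "S = T" using disjoint_treesD[OF assms(1) S(1) assms(2)] assms(4) by blast
  then show ?thesis using S by simp
qed

lemma forest_order_Restr:
  assumes "disjoint_trees F" "T \<in> F"
  shows "Restr (forest_order F) (verts T) = tree_order T"
  using forest_order_tree[OF assms] tree_order_subset[of T] assms(2)
  by (auto simp: forest_order_def)

text \<open>\<open>sep\<close> excludes overlaps and edges between pieces, so every axiom reduces to
  a single piece.\<close>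

lemma elim_order_Union:
  assumes sep: "\<And>Y Z u w. Y \<in> P \<Longrightarrow> Z \<in> P \<Longrightarrow> u \<in> Y \<Longrightarrow> w \<in> Z \<Longrightarrow> (u, w) \<in> E \<or> u = w \<Longrightarrow> Y = Z"
    and ord: "\<And>Y. Y \<in> P \<Longrightarrow> elim_order E Y (r Y)"
  shows "elim_order E (\<Union>P) (\<Union>Y\<in>P. r Y)"
proof -
  let ?R = "\<Union>Y\<in>P. r Y"
  have sub: "u \<in> Y" "v \<in> Y" if "Y \<in> P" "(u, v) \<in> r Y" for Y u v
    using elim_order.sub[OF ord] that by blast+
  have R: "(u, v) \<in> r Y" if Y: "Y \<in> P" "u \<in> Y \<or> v \<in> Y" and uv: "(u, v) \<in> ?R" for Y u v
  proof -
    obtain Z where Z: "Z \<in> P" "(u, v) \<in> r Z" using uv by auto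
    then have "Y = Z" using sep[OF Y(1) Z(1)] sub[OF Z] Y(2) by blast
    then show ?thesis using Z by simp
  qed
  have b: "below ?R v = below (r Y) v" if "Y \<in> P" "v \<in> Y" for Y v
    using R[OF that(1)] that by auto
  show ?thesis
  proof
    show "u \<in> \<Union>P \<and> v \<in> \<Union>P" if "(u, v) \<in> ?R" for u v using that sub by blast
    show "(v, v) \<in> ?R" if "v \<in> \<Union>P" for v using that elim_order.refl[OF ord] by blast
    show "(u, w) \<in> ?R" if a: "(u, v) \<in> ?R" and b: "(v, w) \<in> ?R" for u v w
    proof -
      obtain Y where Y: "Y \<in> P" "(u, v) \<in> r Y" using a by blast
      then have "(v, w) \<in> r Y" using R[OF Y(1) _ b] sub[OF Y] by blast
      then show ?thesis using elim_order.trans[OF ord[OF Y(1)] Y(2)] Y(1) by blast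
    qed
    show "u = v" if a: "(u, v) \<in> ?R" and b: "(v, u) \<in> ?R" for u v
    proof -
      obtain Y where Y: "Y \<in> P" "(u, v) \<in> r Y" using a by blast
      then have "(v, u) \<in> r Y" using R[OF Y(1) _ b] sub[OF Y] by blast
      then show ?thesis using elim_order.antisym[OF ord[OF Y(1)] Y(2)] by blast
    qed
    show "(v, w) \<in> ?R \<or> (w, v) \<in> ?R" if a: "(u, v) \<in> ?R" and b: "(u, w) \<in> ?R" for u v w
    proof -
      obtain Y where Y: "Y \<in> P" "(u, v) \<in> r Y" using a by blast
      then have "(u, w) \<in> r Y" using R[OF Y(1) _ b] sub[OF Y] by blast
      then show ?thesis using elim_order.chain[OF ord[OF Y(1)] Y(2)] Y(1) by blast
    qed
    show "(u, v) \<in> ?R \<or> (v, u) \<in> ?R" if u: "u \<in> \<Union>P" and v: "v \<in> \<Union>P" and e: "(u, v) \<in> E" for u v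
    proof -
      obtain Y Z where Y: "Y \<in> P" "u \<in> Y" "Z \<in> P" "v \<in> Z" using u v by blast
      then have "Y = Z" using sep[of Y Z u v] e by blast
      then show ?thesis using elim_order.edge[OF ord[OF Y(1)] Y(2), of v] Y e by blast
    qed
    show "connected_on E (below ?R v)" if "v \<in> \<Union>P" for v
    proof -
      obtain Y where Y: "Y \<in> P" "v \<in> Y" using \<open>v \<in> \<Union>P\<close> by blast
      then show ?thesis using b[OF Y] elim_order.conn[OF ord[OF Y(1)] Y(2)] by simp
    qed
  qed
qed

lemma elim_order_add_root:
  assumes "elim_order E (K - {x}) R" "connected_on E K" "x \<in> K"
  shows "elim_order E K (K \<times> {x} \<union> R)"
proof -
  interpret R: elim_order E "K - {x}" R by fact
  have sub: "u \<in> K" "v \<in> K" "u \<noteq> x" "v \<noteq> x" if "(u, v) \<in> R" for u v using R.sub[OF that] by auto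
  have b: "below (K \<times> {x} \<union> R) v = (if v = x then K else below R v)" for v
    using sub by auto
  show ?thesis
  proof
    show "connected_on E (below (K \<times> {x} \<union> R) v)" if "v \<in> K" for v
      unfolding b using that assms(2) R.conn by auto
    show "(u, v) \<in> K \<times> {x} \<union> R \<or> (v, u) \<in> K \<times> {x} \<union> R"
      if "u \<in> K" "v \<in> K" "(u, v) \<in> E" for u v
      using that R.edge[of u v] by auto
    show "(v, v) \<in> K \<times> {x} \<union> R" if "v \<in> K" for v using that R.refl[of v] by auto
    show "(u, w) \<in> K \<times> {x} \<union> R" if "(u, v) \<in> K \<times> {x} \<union> R" "(v, w) \<in> K \<times> {x} \<union> R" for u v w
      using that R.trans[of u v w] sub[of u v] sub[of v w] by blast
    show "u = v" if "(u, v) \<in> K \<times> {x} \<union> R" "(v, u) \<in> K \<times> {x} \<union> R" for u v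
      using that R.antisym[of u v] sub[of u v] sub[of v u] by blast
    show "(v, w) \<in> K \<times> {x} \<union> R \<or> (w, v) \<in> K \<times> {x} \<union> R"
      if "(u, v) \<in> K \<times> {x} \<union> R" "(u, w) \<in> K \<times> {x} \<union> R" for u v w
      using that R.chain[of u v w] sub[of u v] sub[of u w] assms(3) by blast
    show "u \<in> K \<and> v \<in> K" if "(u, v) \<in> K \<times> {x} \<union> R" for u v
      using that sub[of u v] assms(3) by blast
  qed
qed

lemma wf_forest_components:
  assumes "sym E"
    and f: "\<And>L. L \<in> components E V \<Longrightarrow> wf_tree (f L) \<and> verts (f L) = L \<and> elim_order E L (tree_order (f L))"
  shows "wf_forest (f ` components E V)" "\<Union>(verts ` f ` components E V) = V"
    "elim_order E V (forest_order (f ` components E V))"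
proof -
  show "wf_forest (f ` components E V)"
    unfolding wf_forest_def disjoint_trees_def
    using f components_disjoint[OF assms(1)] by auto metis
  have "verts ` f ` components E V = components E V" using f by force
  then show "\<Union>(verts ` f ` components E V) = V" using Union_components by simp
  have "elim_order E (\<Union>(components E V)) (\<Union>L\<in>components E V. tree_order (f L))"
  proof (rule elim_order_Union)
    fix Y Z u w assume *: "Y \<in> components E V" "Z \<in> components E V" "u \<in> Y" "w \<in> Z" "(u, w) \<in> E \<or> u = w"
    then have "w \<in> Y" using components_closed[OF *(1,3)] components_subset[OF *(2)] by blast
    then show "Y = Z" using components_disjoint[OF assms(1) *(1,2)] *(4) by blast
  qed (use f in blast)
  then show "elim_order E V (forest_order (f ` components E V))"
    by (simp add: Union_components forest_order_def)
qed

lemma elim_tree_order: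
  assumes "sym E" "elim_tree E K T"
  shows "wf_tree T \<and> verts T = K \<and> elim_order E K (tree_order T)"
  using assms(2)
proof (induction rule: elim_tree.induct)
  case (elim_node K x f C)
  have wf: "wf_forest (fset C)" "\<Union>(verts ` fset C) = K - {x}" "elim_order E (K - {x}) (forest_order (fset C))"
    using wf_forest_components[OF assms(1), of "K - {x}" f] elim_node.IH
    unfolding elim_node.hyps(3)[symmetric] by blast+
  moreover have "verts (Node x C) = K" using wf(2) elim_node.hyps(2) by auto
  ultimately show ?case
    unfolding tree_order_Node wf_tree_Node
    using elim_order_add_root[OF wf(3) elim_node.hyps(1,2)] by auto
qed

lemma elim_order_tree:
  assumes "disjoint_trees F" "elim_order E V (forest_order F)" "\<Union>(verts ` F) = V" "T \<in> F"
  shows "elim_order E (verts T) (tree_order T)"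
proof -
  have "elim_order E (verts T) (Restr (forest_order F) (verts T))"
  proof (rule elim_order_restrict[OF assms(2)])
    show "verts T \<subseteq> V" using assms(3,4) by auto
    fix u v assume "v \<in> verts T" "(u, v) \<in> forest_order F"
    then show "u \<in> verts T" using forest_order_tree[OF assms(1,4)] tree_order_subset by blast
  qed
  then show ?thesis using forest_order_Restr[OF assms(1,4)] by simp
qed

text \<open>Adjacent vertices are comparable and comparable vertices share a tree, so no edge joins
  two trees; as each tree is connected, the vertex sets of the trees are the components.\<close>

lemma components_wf_forest:
  assumes "sym E" "disjoint_trees F" "elim_order E V (forest_order F)" "\<Union>(verts ` F) = V"
    and tr: "\<And>T. T \<in> F \<Longrightarrow> elim_tree E (verts T) T"
  shows "\<exists>f. (\<forall>K\<in>components E V. elim_tree E K (f K)) \<and> F = f ` components E V"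
proof -
  interpret elim_order E V "forest_order F" by fact
  have comps: "components E V = verts ` F"
  proof (rule components_eqI[OF assms(1,4)])
    show "connected_on E Y" if "Y \<in> verts ` F" for Y
      using that tr by (auto elim: elim_tree.cases)
    fix Y Z u w assume Y: "Y \<in> verts ` F" "Z \<in> verts ` F" "u \<in> Y" "w \<in> Z" "(u, w) \<in> E \<or> u = w"
    then obtain S T where S: "S \<in> F" "T \<in> F" "Y = verts S" "Z = verts T" by blast
    have "u \<in> V" "w \<in> V" using Y assms(4) by blast+
    then have "(u, w) \<in> forest_order F \<or> (w, u) \<in> forest_order F"
      using edge Y(5) refl by blast
    then have "(u, w) \<in> tree_order S \<or> (w, u) \<in> tree_order S"
      using forest_order_tree[OF assms(2) S(1)] Y(3) S(3) by blast
    then have "w \<in> verts S" using tree_order_subset by blast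
    then show "Y = Z" using disjoint_treesD[OF assms(2) S(1,2)] S Y(4) by blast
  qed
  have inj: "inj_on verts F"
  proof (rule inj_onI)
    fix S T assume S: "S \<in> F" "T \<in> F" "verts S = verts T"
    obtain u where "u \<in> verts S" using verts_nonempty[of S] by blast
    then show "S = T" using disjoint_treesD[OF assms(2) S(1,2), of u] S(3) by simp
  qed
  define f where "f = inv_into F verts"
  have f: "f (verts T) = T" if "T \<in> F" for T using inv_into_f_f[OF inj that] by (simp add: f_def)
  show ?thesis
    by (rule exI[of _ f]) (use comps f tr in \<open>force simp: image_image\<close>)
qed

lemma forest_order_child:
  assumes "wf_tree (Node x C)" "elim_order E (verts (Node x C)) (tree_order (Node x C))"
  shows "elim_order E (\<Union>(verts ` fset C)) (forest_order (fset C))"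
proof -
  let ?K = "verts (Node x C)" and ?W = "\<Union>(verts ` fset C)"
  have x: "x \<notin> ?W" using assms(1) by (simp add: wf_tree_Node)
  have sub: "forest_order (fset C) \<subseteq> ?W \<times> ?W"
    using tree_order_subset by (fastforce simp: forest_order_def)
  have "elim_order E ?W (Restr (tree_order (Node x C)) ?W)"
    by (rule elim_order_restrict[OF assms(2)]) (use x sub in \<open>auto simp: tree_order_Node\<close>)
  moreover have "Restr (tree_order (Node x C)) ?W = forest_order (fset C)"
    using x sub unfolding tree_order_Node by blast
  ultimately show ?thesis by simp
qed

lemma below_root:
  assumes "wf_tree (Node x C)"
  shows "below (tree_order (Node x C)) x = verts (Node x C)"
  using assms tree_order_subset unfolding tree_order_Node wf_tree_Node forest_order_def below_def
  by fastforce

text \<open>The down-set of the root is the whole tree, so \<open>conn\<close> at the root gives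
  connectedness; the child subtrees form a forest of the same kind on the remaining
  vertices.\<close>

lemma elim_treeI:
  assumes "sym E"
  shows "wf_tree T \<Longrightarrow> elim_order E (verts T) (tree_order T) \<Longrightarrow> elim_tree E (verts T) T"
proof (induction T)
  case (Node x C)
  let ?K = "verts (Node x C)" and ?W = "\<Union>(verts ` fset C)"
  interpret elim_order E ?K "tree_order (Node x C)" by fact
  have wf: "wf_forest (fset C)" and x: "x \<notin> ?W" using Node.prems(1) by (simp_all add: wf_tree_Node)
  have dis: "disjoint_trees (fset C)" using wf by (simp add: wf_forest_def)
  note ord = forest_order_child[OF Node.prems]
  have W: "?K - {x} = ?W" using x by auto
  have tr: "elim_tree E (verts S) S" if "S \<in> fset C" for S
    using Node.IH[OF that] elim_order_tree[OF dis ord _ that] wf that by (simp add: wf_forest_def)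
  obtain f where f: "\<forall>L\<in>components E ?W. elim_tree E L (f L)" "fset C = f ` components E ?W"
    using components_wf_forest[OF assms dis ord _ tr] by blast
  show ?case
  proof (rule elim_tree.elim_node)
    show "connected_on E ?K" using conn[of x] below_root[OF Node.prems(1)] by simp
    show "x \<in> ?K" by simp
    show "\<forall>L\<in>components E (?K - {x}). elim_tree E L (f L)" "fset C = f ` components E (?K - {x})"
      unfolding W by (fact f)+
  qed
qed

text \<open>The bridge between recursive trees and axiomatic orders: validity of a rotated forest
  can now be read off from its order and the disjointness of its trees.\<close>

lemma elim_forests_iff:
  assumes "sym E"
  shows "F \<in> elim_forests E V \<longleftrightarrow>
    wf_forest F \<and> \<Union>(verts ` F) = V \<and> elim_order E V (forest_order F)"
proof
  assume "F \<in> elim_forests E V"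
  then obtain f where f: "\<forall>K \<in> components E V. elim_tree E K (f K)" "F = f ` components E V"
    by (auto simp: elim_forests_def)
  then show "wf_forest F \<and> \<Union>(verts ` F) = V \<and> elim_order E V (forest_order F)"
    using wf_forest_components[OF assms, of V f] elim_tree_order[OF assms] by blast
next
  assume F: "wf_forest F \<and> \<Union>(verts ` F) = V \<and> elim_order E V (forest_order F)"
  then have dis: "disjoint_trees F" by (simp add: wf_forest_def)
  have "elim_tree E (verts T) T" if "T \<in> F" for T
    using elim_treeI[OF assms, of T] elim_order_tree[OF dis, of E V T] F that by (simp add: wf_forest_def)
  then show "F \<in> elim_forests E V"
    using components_wf_forest[OF assms dis] F unfolding elim_forests_def by blast
qed

lemma forest_order_components:
  assumes "sym E" "\<forall>L \<in> components E V. elim_tree E L (f L)" "K \<in> components E V"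
  shows "Restr (forest_order (f ` components E V)) K = tree_order (f K)"
proof -
  have "wf_forest (f ` components E V)"
    using wf_forest_components(1)[OF assms(1), of V f] elim_tree_order[OF assms(1)] assms(2) by blast
  then have "Restr (forest_order (f ` components E V)) (verts (f K)) = tree_order (f K)"
    using assms(3) by (intro forest_order_Restr) (auto simp: wf_forest_def)
  then show ?thesis using elim_tree_order[OF assms(1)] assms(2,3) by metis
qed

text \<open>The root is the greatest element, so antisymmetry makes the roots equal; the rest of the
  order splits over the components.\<close>

lemma tree_order_inj:
  assumes "sym E" "elim_tree E K T" "elim_tree E K T'" "tree_order T = tree_order T'"
  shows "T = T'"
  using assms(2-4)
proof (induction arbitrary: T' rule: elim_tree.induct)
  case (elim_node K x f C)
  from elim_node.prems(1) obtain y g D where T': "T' = Node y D" "y \<in> K"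
    and g: "\<forall>L \<in> components E (K - {y}). elim_tree E L (g L)" and D: "fset D = g ` components E (K - {y})"
    by (auto elim: elim_tree.cases)
  have f: "\<forall>L \<in> components E (K - {x}). elim_tree E L (f L)" using elim_node.IH by blast
  have T: "elim_tree E K (Node x C)"
    by (rule elim_tree.elim_node) (use elim_node in auto)
  note wT = elim_tree_order[OF assms(1) T] and wT' = elim_tree_order[OF assms(1) elim_node.prems(1)]
  interpret elim_order E K "tree_order (Node x C)" using wT by blast
  have "(y, x) \<in> tree_order (Node x C)" using wT T'(2) unfolding tree_order_Node by auto
  moreover have "x \<in> verts T'" using wT' elim_node.hyps(2) by blast
  then have "(x, y) \<in> tree_order T'" unfolding T'(1) tree_order_Node by blast
  then have "(x, y) \<in> tree_order (Node x C)" unfolding elim_node.prems(2) .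
  ultimately have y: "y = x" using antisym by blast
  have R: "Restr (tree_order (Node z B)) (K - {z}) = forest_order (fset B)"
    if "wf_tree (Node z B)" "verts (Node z B) = K" for z B
  proof -
    have *: "\<Union>(verts ` fset B) = K - {z}" using that by (auto simp: wf_tree_Node)
    have "forest_order (fset B) \<subseteq> (K - {z}) \<times> (K - {z})"
      using tree_order_subset unfolding *[symmetric] by (fastforce simp: forest_order_def)
    then show ?thesis unfolding tree_order_Node that(2) by blast
  qed
  have "forest_order (fset C) = forest_order (fset D)"
    using R[of x C] R[of x D] wT wT' elim_node.prems(2) T'(1) y by metis
  then have eq: "forest_order (f ` components E (K - {x})) = forest_order (g ` components E (K - {x}))"
    using elim_node.hyps D y by simp
  have "f L = g L" if L: "L \<in> components E (K - {x})" for L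
  proof -
    have "tree_order (f L) = tree_order (g L)"
      using forest_order_components[OF assms(1) f L] forest_order_components[OF assms(1) g[unfolded y] L] eq
      by simp
    then show ?thesis using elim_node.IH L g y by blast
  qed
  then have "fset C = fset D" using elim_node.hyps D y by simp
  then show ?case using T'(1) y by (simp add: fset_inject)
qed

lemma forest_order_inj:
  assumes "sym E" "F \<in> elim_forests E V" "F' \<in> elim_forests E V" "forest_order F = forest_order F'"
  shows "F = F'"
proof -
  obtain f where f: "\<forall>K \<in> components E V. elim_tree E K (f K)" "F = f ` components E V"
    using assms(2) by (auto simp: elim_forests_def)
  obtain g where g: "\<forall>K \<in> components E V. elim_tree E K (g K)" "F' = g ` components E V"
    using assms(3) by (auto simp: elim_forests_def)
  have "f K = g K" if K: "K \<in> components E V" for K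
    using tree_order_inj[OF assms(1)] f(1) g(1) K
      forest_order_components[OF assms(1) f(1) K] forest_order_components[OF assms(1) g(1) K]
      assms(4) f(2) g(2) by metis
  then show ?thesis using f(2) g(2) by simp
qed

section \<open>Rotations of trees\<close>

text \<open>A local variant of \<open>rot_order\<close>: it gives the down-set of \<open>i\<close>
  explicitly and does not claim that \<open>R'\<close> is an elimination order. So it can be checked
  in a subtree and carried to the whole forest.\<close>

definition rotates :: "nat rel \<Rightarrow> nat \<Rightarrow> nat \<Rightarrow> nat rel \<Rightarrow> nat rel \<Rightarrow> bool" where
  "rotates E i j R R' \<longleftrightarrow> covers R i j \<and> below R' j = below R i \<and>
     below R' i = component_of E (below R i - {j}) i \<and>
     (\<forall>v. v \<noteq> i \<longrightarrow> v \<noteq> j \<longrightarrow> below R' v = below R v)"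

text \<open>\<open>R'\<close> has the down-sets of the rotation supplied by
  \<open>rot_order_exists\<close> and thereby inherits the axioms.\<close>

lemma rotates_rot_order:
  assumes "sym E" "elim_order E V R" "rotates E i j R R'"
  shows "rot_order E V i j R R'"
proof -
  obtain R'' where R'': "rot_order E V i j R R''"
    using rot_order_exists[OF assms(1,2)] assms(3) unfolding rotates_def by blast
  have "below R' v = below R'' v" for v
  proof -
    consider "v = i" | "v = j" | "v \<noteq> i" "v \<noteq> j" by blast
    then show ?thesis
    proof cases
      case 1
      then show ?thesis using rot_order_below[OF R''] assms(3) by (simp add: rotates_def)
    next
      case 2
      then show ?thesis using R'' assms(3) unfolding rotates_def rot_order_def by metis
    next
      case 3
      then show ?thesis using R'' assms(3) unfolding rotates_def rot_order_def by metis
    qed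
  qed
  then have "R' = R''" by (rule below_eqI)
  then show ?thesis using R'' by simp
qed

text \<open>\<open>Q\<close> enlarges only down-sets of vertices outside \<open>L\<close>, while
  \<open>i\<close>, \<open>j\<close> and all that lies between them stay in \<open>L\<close>. This
  passes from a subtree to its tree and from a tree to the forest.\<close>

lemma rotates_Un:
  assumes "rotates E i j R R'" "R \<subseteq> L \<times> L" "R' \<subseteq> L \<times> L" "\<And>u v. (u, v) \<in> Q \<Longrightarrow> v \<notin> L"
  shows "rotates E i j (R \<union> Q) (R' \<union> Q)"
proof -
  have L: "i \<in> L" "j \<in> L" using assms(1,2) unfolding rotates_def covers_def by blast+
  have b: "below (R \<union> Q) v = below R v" "below (R' \<union> Q) v = below R' v" if "v \<in> L" for v
    using assms(4) that by auto
  have o: "below (R \<union> Q) v = below R v \<union> below Q v" "below (R' \<union> Q) v = below R' v \<union> below Q v" for v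
    by auto
  have "covers (R \<union> Q) i j"
    unfolding covers_def
  proof (intro conjI allI impI)
    show "i \<noteq> j" "(j, i) \<in> R \<union> Q" using assms(1) unfolding rotates_def covers_def by blast+
    fix w assume w: "(j, w) \<in> R \<union> Q" "(w, i) \<in> R \<union> Q"
    then have wi: "(w, i) \<in> R" using assms(4) L by blast
    then have "w \<in> L" using assms(2) by blast
    then have "(j, w) \<in> R" using w(1) assms(4) by blast
    then show "w = i \<or> w = j" using wi assms(1) unfolding rotates_def covers_def by blast
  qed
  moreover have "below (R' \<union> Q) v = below (R \<union> Q) v" if "v \<noteq> i" "v \<noteq> j" for v
    unfolding o using assms(1) that unfolding rotates_def by metis
  ultimately show ?thesis
    using assms(1) b L unfolding rotates_def by simp
qed

lemma forest_order_insert: "forest_order (insert T F) = tree_order T \<union> forest_order F"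
  by (simp add: forest_order_def)

lemma forest_order_Un: "forest_order (F \<union> G) = forest_order F \<union> forest_order G"
  by (auto simp: forest_order_def)

lemma forest_order_subset: "forest_order F \<subseteq> \<Union>(verts ` F) \<times> \<Union>(verts ` F)"
  using tree_order_subset by (fastforce simp: forest_order_def)

lemma wf_forest_subset: "wf_forest F \<Longrightarrow> G \<subseteq> F \<Longrightarrow> wf_forest G"
  unfolding wf_forest_def disjoint_trees_def by (meson subsetD)

lemma wf_forest_insert:
  assumes "wf_forest (insert T F)" "T \<notin> F"
  shows "wf_tree T \<and> wf_forest F \<and> verts T \<inter> \<Union>(verts ` F) = {}"
proof (intro conjI)
  show "wf_tree T" using assms by (simp add: wf_forest_def)
  show "wf_forest F" using wf_forest_subset[OF assms(1)] by blast
  have "verts T \<inter> verts S = {}" if "S \<in> F" for S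
  proof -
    have "T \<noteq> S" using assms(2) that by metis
    then show ?thesis using assms(1) that unfolding wf_forest_def disjoint_trees_def by (meson insertCI)
  qed
  then show "verts T \<inter> \<Union>(verts ` F) = {}" by (simp add: Int_UN_distrib)
qed

lemma wf_forest_UnI:
  assumes "wf_forest F" "wf_forest G" "\<Union>(verts ` F) \<inter> \<Union>(verts ` G) = {}"
  shows "wf_forest (F \<union> G)"
proof -
  have *: "verts S \<inter> verts T = {}" if "S \<in> F" "T \<in> G" for S T
    using assms(3) UN_upper[OF that(1), of verts] UN_upper[OF that(2), of verts] by blast
  have "verts S \<inter> verts T = {}" if "S \<in> F \<union> G" "T \<in> F \<union> G" "S \<noteq> T" for S T
    using that assms(1,2) *[of S T] *[of T S] unfolding wf_forest_def disjoint_trees_def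
    by (metis Int_commute UnE)
  then show ?thesis using assms(1,2) by (auto simp: wf_forest_def disjoint_trees_def)
qed

lemma wf_forest_insertI:
  assumes "wf_tree T" "wf_forest F" "verts T \<inter> \<Union>(verts ` F) = {}"
  shows "wf_forest (insert T F)"
proof -
  have "wf_forest {T}" using assms(1) by (simp add: wf_forest_def disjoint_trees_def)
  then show ?thesis using wf_forest_UnI[of "{T}" F] assms by simp
qed

lemma elim_order_child:
  assumes "wf_tree (Node x C)" "elim_order E (verts (Node x C)) (tree_order (Node x C))" "S \<in> fset C"
  shows "wf_tree S" "elim_order E (verts S) (tree_order S)"
  using elim_order_tree[OF _ forest_order_child[OF assms(1,2)] _ assms(3)] assms(1,3)
  by (simp_all add: wf_tree_Node wf_forest_def)

lemma elim_order_connected: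
  assumes "wf_tree T" "elim_order E (verts T) (tree_order T)"
  shows "connected_on E (verts T)"
proof (cases T)
  case (Node x C)
  then show ?thesis using elim_order.conn[OF assms(2), of x] below_root[of x C] assms(1) by simp
qed

text \<open>The point is that the filter on the subtrees of \<open>j\<close> reproduces the
  component of \<open>i\<close> in \<open>H - {j}\<close>: every other subtree of \<open>i\<close>
  lies in it, and a subtree of \<open>j\<close> lies inside it or is disjoint from it.\<close>

lemma rot_here_rotates:
  fixes E :: "nat rel" and i j :: nat and C D :: "nat rtree fset"
  defines "T \<equiv> Node i (finsert (Node j D) C)"
  defines "H \<equiv> verts T"
  defines "D1 \<equiv> ffilter (same_component E (H - {j}) i) D"
  defines "D2 \<equiv> ffilter (\<lambda>S. \<not> same_component E (H - {j}) i S) D"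
  defines "T' \<equiv> Node j (finsert (Node i (C |\<union>| D1)) D2)"
  assumes "sym E" "wf_tree T" "elim_order E (verts T) (tree_order T)" "Node j D |\<notin>| C"
  shows "wf_tree T' \<and> verts T' = verts T \<and> rotates E i j (tree_order T) (tree_order T')"
proof -
  define VC where "VC = \<Union>(verts ` fset C)"
  define VD where "VD = \<Union>(verts ` fset D)"
  define V1 where "V1 = \<Union>(verts ` fset D1)"
  define V2 where "V2 = \<Union>(verts ` fset D2)"
  have D12: "fset D = fset D1 \<union> fset D2" "fset D1 \<inter> fset D2 = {}"
    unfolding D1_def D2_def by auto
  have VD12: "VD = V1 \<union> V2" unfolding VD_def V1_def V2_def D12(1) by blast
  have wfT: "i \<notin> insert j VD \<union> VC" "wf_forest (insert (Node j D) (fset C))"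
    using \<open>wf_tree T\<close> unfolding T_def wf_tree_Node VC_def VD_def by auto
  have "wf_tree (Node j D)" and wfC: "wf_forest (fset C)" and jC: "insert j VD \<inter> VC = {}"
    using wf_forest_insert[OF wfT(2)] \<open>Node j D |\<notin>| C\<close> unfolding VC_def VD_def by auto
  then have j: "j \<notin> VD" and wfD: "wf_forest (fset D)" unfolding wf_tree_Node VD_def by auto
  have wf1: "wf_forest (fset D1)" and wf2: "wf_forest (fset D2)"
    using wf_forest_subset[OF wfD] D12(1) by blast+
  have V12: "V1 \<inter> V2 = {}"
  proof (rule ccontr)
    assume "V1 \<inter> V2 \<noteq> {}"
    then obtain u S S' where u: "S \<in> fset D1" "S' \<in> fset D2" "u \<in> verts S" "u \<in> verts S'"
      unfolding V1_def V2_def by blast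
    then have "S = S'" using disjoint_treesD[of "fset D" S S' u] wfD D12(1) by (simp add: wf_forest_def)
    then show False using u(1,2) D12(2) by blast
  qed
  have ij: "i \<noteq> j" using wfT by blast
  have H: "H = insert i (insert j VD \<union> VC)" unfolding H_def T_def VC_def VD_def by auto
  have vA: "verts (Node i (C |\<union>| D1)) = insert i (VC \<union> V1)" unfolding VC_def V1_def by auto
  have wfA: "wf_tree (Node i (C |\<union>| D1))"
  proof -
    have "wf_forest (fset C \<union> fset D1)"
      by (rule wf_forest_UnI[OF wfC wf1]) (use jC VD12 in \<open>unfold VC_def[symmetric] V1_def[symmetric], blast\<close>)
    moreover have "i \<notin> \<Union>(verts ` (fset C \<union> fset D1))" using wfT VD12 unfolding VC_def V1_def by blast
    ultimately show ?thesis unfolding wf_tree_Node by simp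
  qed
  have "wf_forest (insert (Node i (C |\<union>| D1)) (fset D2))"
    by (rule wf_forest_insertI[OF wfA wf2])
      (use wfT jC VD12 V12 in \<open>unfold vA V2_def[symmetric], blast\<close>)
  moreover have "j \<notin> \<Union>(verts ` insert (Node i (C |\<union>| D1)) (fset D2))"
  proof -
    have "\<Union>(verts ` insert (Node i (C |\<union>| D1)) (fset D2)) = insert i (VC \<union> V1) \<union> V2"
      by (simp only: image_insert Union_insert vA V2_def)
    moreover have "j \<notin> VC" "j \<notin> V1" "j \<notin> V2" using jC j VD12 by blast+
    ultimately show ?thesis using ij by simp
  qed
  ultimately have wfT': "wf_tree T'" unfolding T'_def wf_tree_Node by simp
  have "verts T' = insert j (insert i (VC \<union> V1) \<union> V2)"
    by (simp only: T'_def verts_Node[of j] finsert.rep_eq image_insert Union_insert vA V2_def)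
  then have vT': "verts T' = H" using H VD12 by blast
  have ordT: "tree_order T = H \<times> {i} \<union> (insert j VD \<times> {j} \<union> forest_order (fset D)) \<union> forest_order (fset C)"
    unfolding T_def tree_order_Node H_def VD_def by (simp add: forest_order_insert tree_order_Node Un_assoc)
  have ordT': "tree_order T' = H \<times> {j} \<union> (insert i (VC \<union> V1) \<times> {i} \<union> forest_order (fset D)) \<union> forest_order (fset C)"
    unfolding T'_def tree_order_Node vT'[unfolded T'_def] D12(1)
    by (simp only: finsert.rep_eq union_fset forest_order_insert forest_order_Un tree_order_Node vA) blast
  have subC: "forest_order (fset C) \<subseteq> VC \<times> VC" and subD: "forest_order (fset D) \<subseteq> VD \<times> VD"
    using forest_order_subset unfolding VC_def VD_def by blast+
  have bi: "below (tree_order T) i = H"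
    unfolding ordT below_def using wfT(1) subC subD by blast
  interpret R: elim_order E H "tree_order T" using assms(8) unfolding H_def .
  let ?K = "component_of E (H - {j}) i"
  have iK: "i \<in> ?K" using ij H by (intro component_of_self) auto
  have conn: "connected_on E (verts S)" if "S \<in> fset C \<union> fset D" for S
  proof -
    note ch = elim_order_child[OF \<open>wf_tree T\<close>[unfolded T_def] assms(8)[unfolded T_def]]
    have "Node j D \<in> fset (finsert (Node j D) C)" by simp
    note ch' = elim_order_child[OF ch[OF this]]
    show ?thesis using that ch ch' elim_order_connected by fastforce
  qed
  \<comment> \<open>Comparability confines edges leaving such a subtree to those ending at
    \<open>i\<close>, so connectedness of \<open>H\<close> yields an edge between it and
    \<open>i\<close>.\<close>
  have C_K: "verts S \<subseteq> ?K" if S: "S \<in> fset C" for S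
  proof -
    have SV: "verts S \<subseteq> VC" using S unfolding VC_def by blast
    then have iS: "i \<notin> verts S" and jS: "j \<notin> verts S" using wfT(1) jC by blast+
    have up: "w = i \<or> w \<in> verts S" if "(u, w) \<in> tree_order T" "u \<in> verts S" for u w
    proof -
      have "u \<in> VC" using that SV by blast
      then have "w = i \<or> (u, w) \<in> forest_order (fset C)" using that(1) jC subD unfolding ordT by blast
      then show ?thesis
        using forest_order_tree[of "fset C" S u w] wfC S that(2) tree_order_subset
        unfolding wf_forest_def by blast
    qed
    have down: "u \<in> verts S" if "(u, w) \<in> tree_order T" "w \<in> verts S" for u w
    proof -
      have "w \<in> VC" using that SV by blast
      then have "(u, w) \<in> forest_order (fset C)" using that(1) jC subD wfT(1) unfolding ordT by blast
      then show ?thesis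
        using forest_order_tree[of "fset C" S u w] wfC S that(2) tree_order_subset
        unfolding wf_forest_def by blast
    qed
    have "\<exists>u \<in> verts S. (u, i) \<in> E"
    proof (rule ccontr)
      assume n: "\<not> ?thesis"
      obtain a where a: "a \<in> verts S" using verts_nonempty[of S] by blast
      have "connected_on E H" using R.conn[of i] bi H by simp
      then have "H \<subseteq> verts S"
      proof (rule connected_on_induct)
        show "a \<in> H" using a SV H by blast
        show "a \<in> verts S" by fact
        fix u w assume u: "u \<in> H" "u \<in> verts S" "w \<in> H" "(u, w) \<in> E"
        then show "w \<in> verts S" using R.edge[OF u(1,3,4)] up[OF _ u(2)] down[OF _ u(2)] n by blast
      qed
      then show False using iS H by blast
    qed
    then obtain u where u: "u \<in> verts S" "(i, u) \<in> E" using symD[OF \<open>sym E\<close>] by blast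
    have SH: "verts S \<subseteq> H - {j}" using SV jS H by blast
    then have "u \<in> ?K" using component_of_closed[OF iK _ u(2)] u(1) by blast
    then show ?thesis using connected_on_subset_component_of[OF conn SH u(1)] S by blast
  qed
  have D_K: "verts S \<subseteq> ?K \<longleftrightarrow> same_component E (H - {j}) i S" for S
  proof
    assume "verts S \<subseteq> ?K"
    moreover have "i \<in> H - {j}" using ij H by simp
    then have "?K \<in> components E (H - {j})" unfolding components_eq by (rule imageI)
    ultimately show "same_component E (H - {j}) i S" unfolding same_component_def using iK by metis
  next
    assume "same_component E (H - {j}) i S"
    then obtain K where K: "K \<in> components E (H - {j})" "i \<in> K" "verts S \<subseteq> K"
      unfolding same_component_def by blast
    then obtain a where "K = component_of E (H - {j}) a" unfolding components_eq by (elim imageE)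
    then show "verts S \<subseteq> ?K" using component_of_eq[OF \<open>sym E\<close>, of i "H - {j}" a] K by simp
  qed
  have "?K = insert i (VC \<union> V1)"
  proof
    show "insert i (VC \<union> V1) \<subseteq> ?K"
    proof -
      have "verts S \<subseteq> ?K" if "S \<in> fset D1" for S using that D_K unfolding D1_def by simp
      then show ?thesis using iK C_K unfolding VC_def V1_def by blast
    qed
    show "?K \<subseteq> insert i (VC \<union> V1)"
    proof
      fix w assume w: "w \<in> ?K"
      then have wH: "w \<in> H" "w \<noteq> j" using component_of_subset[of E "H - {j}" i] by blast+
      show "w \<in> insert i (VC \<union> V1)"
      proof (rule ccontr)
        assume "w \<notin> insert i (VC \<union> V1)"
        then have "w \<in> V2" using wH H VD12 by blast
        then obtain S where S: "S \<in> fset D2" "w \<in> verts S" unfolding V2_def by blast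
        have SD: "S \<in> fset D" using S D12 by blast
        then have "verts S \<subseteq> VD" unfolding VD_def by blast
        then have "verts S \<subseteq> H - {j}" using H j by blast
        \<comment> \<open>A connected subtree that meets the component is contained in it, and would
          have passed the filter.\<close>
        then have "verts S \<subseteq> ?K" using connected_on_subset_component_of[OF conn _ S(2) w] SD by blast
        then show False using D_K S(1) unfolding D2_def by simp
      qed
    qed
  qed
  moreover have "below (tree_order T') i = insert i (VC \<union> V1)"
    unfolding ordT' below_def using wfT(1) subC subD ij by blast
  moreover have "below (tree_order T') j = H"
    unfolding ordT' below_def using j jC subC subD ij by blast
  moreover have "below (tree_order T') v = below (tree_order T) v" if "v \<noteq> i" "v \<noteq> j" for v
    unfolding ordT ordT' below_def using that by blast
  moreover have "covers (tree_order T) i j"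
    unfolding covers_def
  proof (intro conjI allI impI)
    show "i \<noteq> j" by fact
    show "(j, i) \<in> tree_order T" unfolding ordT H by blast
    fix w assume "(j, w) \<in> tree_order T"
    then show "w = i \<or> w = j" unfolding ordT using j jC subC subD by blast
  qed
  ultimately have "rotates E i j (tree_order T) (tree_order T')"
    unfolding rotates_def bi by simp
  then show ?thesis using wfT' vT' H_def by simp
qed

lemma rot_tree_rotates:
  assumes "sym E" "rot_tree E i j T T'"
  shows "wf_tree T \<Longrightarrow> elim_order E (verts T) (tree_order T) \<Longrightarrow>
    wf_tree T' \<and> verts T' = verts T \<and> rotates E i j (tree_order T) (tree_order T')"
  using assms(2)
proof (induction rule: rot_tree.induct)
  case (rot_here D C H)
  then show ?case using rot_here_rotates[OF assms(1)] by metis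
next
  case (rot_below T C T' x)
  have "T \<in> fset (finsert T C)" by simp
  note T = elim_order_child[OF rot_below.prems this]
  have IH: "wf_tree T'" "verts T' = verts T" "rotates E i j (tree_order T) (tree_order T')"
    using rot_below.IH T by blast+
  have wf: "x \<notin> verts T \<union> \<Union>(verts ` fset C)" "wf_forest (insert T (fset C))"
    using rot_below.prems(1) unfolding wf_tree_Node by auto
  have C: "wf_forest (fset C)" "verts T \<inter> \<Union>(verts ` fset C) = {}"
    using wf_forest_insert[OF wf(2)] rot_below.hyps(1) by auto
  have v: "verts (Node x (finsert T' C)) = verts (Node x (finsert T C))" using IH(2) by simp
  have "wf_forest (insert T' (fset C))"
    using wf_forest_insertI[OF IH(1) C(1)] C(2) IH(2) by simp
  then have "wf_tree (Node x (finsert T' C))"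
    using wf(1) IH(2) unfolding wf_tree_Node by simp
  moreover have "rotates E i j (tree_order (Node x (finsert T C))) (tree_order (Node x (finsert T' C)))"
  proof -
    \<comment> \<open>The part of the order untouched by a rotation inside \<open>T\<close>; its
      upper ends lie outside \<open>T\<close>.\<close>
    let ?Q = "verts (Node x (finsert T C)) \<times> {x} \<union> forest_order (fset C)"
    have "rotates E i j (tree_order T \<union> ?Q) (tree_order T' \<union> ?Q)"
    proof (rule rotates_Un[OF IH(3) tree_order_subset])
      show "tree_order T' \<subseteq> verts T \<times> verts T" using tree_order_subset[of T'] IH(2) by simp
      show "v \<notin> verts T" if "(u, v) \<in> ?Q" for u v
      proof -
        have "v = x \<or> v \<in> \<Union>(verts ` fset C)" using that subsetD[OF forest_order_subset] by fast
        then show ?thesis using wf(1) C(2) by blast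
      qed
    qed
    moreover have "tree_order T \<union> ?Q = tree_order (Node x (finsert T C))"
      "tree_order T' \<union> ?Q = tree_order (Node x (finsert T' C))"
      unfolding tree_order_Node v by (simp_all add: forest_order_insert Un_ac)
    ultimately show ?thesis by simp
  qed
  ultimately show ?case using v by blast
qed

text \<open>If \<open>i\<close> is the root, the root of the child subtree containing
  \<open>j\<close> lies between \<open>j\<close> and \<open>i\<close>, so it is \<open>j\<close>.
  Otherwise the pair lies in one child subtree, to which covering descends.\<close>

lemma rot_tree_exists:
  assumes "wf_tree T" "covers (tree_order T) i j"
  shows "\<exists>T'. rot_tree E i j T T'"
  using assms
proof (induction T)
  case (Node x C)
  have wf: "x \<notin> \<Union>(verts ` fset C)" "wf_forest (fset C)" using Node.prems(1) by (simp_all add: wf_tree_Node)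
  have cov: "i \<noteq> j" "(j, i) \<in> tree_order (Node x C)"
    "\<And>w. (j, w) \<in> tree_order (Node x C) \<Longrightarrow> (w, i) \<in> tree_order (Node x C) \<Longrightarrow> w = i \<or> w = j"
    using Node.prems(2) unfolding covers_def by blast+
  have child: "(u, v) \<in> tree_order (Node x C)" if "S \<in> fset C" "(u, v) \<in> tree_order S" for S u v
    using that unfolding tree_order_Node forest_order_def by blast
  have split: "finsert S (C |-| {|S|}) = C" "S |\<notin>| C |-| {|S|}" if "S \<in> fset C" for S
    using that by auto
  show ?case
  proof (cases "i = x")
    case True
    have "j \<in> verts (Node x C)" using cov(2) tree_order_subset by blast
    then obtain S where S: "S \<in> fset C" "j \<in> verts S" using cov(1) True by auto
    obtain s D where s: "S = Node s D" by (cases S)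
    have "(j, s) \<in> tree_order S" using S(2) unfolding s tree_order_Node by blast
    moreover have "s \<in> verts (Node x C)" using S(1) s by force
    then have "(s, i) \<in> tree_order (Node x C)" using True unfolding tree_order_Node by blast
    moreover have "s \<noteq> i" using True wf(1) S(1) s by auto
    ultimately have "s = j" using cov(3) child[OF S(1)] by blast
    then have "rot_tree E i j (Node i (finsert (Node j D) (C |-| {|S|})))
       (Node j (finsert (Node i ((C |-| {|S|}) |\<union>| ffilter (same_component E (verts (Node i (finsert (Node j D) (C |-| {|S|}))) - {j}) i) D))
                        (ffilter (\<lambda>U. \<not> same_component E (verts (Node i (finsert (Node j D) (C |-| {|S|}))) - {j}) i U) D)))"
      by (intro rot_tree.rot_here) (use s in auto)
    moreover have "finsert (Node j D) (C |-| {|S|}) = C" using split(1)[OF S(1)] s \<open>s = j\<close> by simp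
    ultimately show ?thesis using True by metis
  next
    case False
    then obtain S where S: "S \<in> fset C" "(j, i) \<in> tree_order S"
      using cov(2) unfolding tree_order_Node forest_order_def by auto
    have "covers (tree_order S) i j"
      unfolding covers_def using cov child[OF S(1)] S(2) by blast
    then obtain S' where "rot_tree E i j S S'"
      using Node.IH[OF S(1)] wf(2) S(1) by (auto simp: wf_forest_def)
    then have "rot_tree E i j (Node x (finsert S (C |-| {|S|}))) (Node x (finsert S' (C |-| {|S|})))"
      using split(2)[OF S(1)] by (intro rot_tree.rot_below)
    then show ?thesis using split(1)[OF S(1)] by metis
  qed
qed

lemma rot_forest_order:
  assumes "sym E" "F \<in> elim_forests E V" "rot_forest E i j F F'"
  shows "F' \<in> elim_forests E V" "rot_order E V i j (forest_order F) (forest_order F')"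
proof -
  have F: "wf_forest F" "\<Union>(verts ` F) = V" "elim_order E V (forest_order F)"
    using assms(2) elim_forests_iff[OF assms(1)] by blast+
  obtain T T' where T: "T \<in> F" "rot_tree E i j T T'" "F' = insert T' (F - {T})"
    using assms(3) by (auto simp: rot_forest_def)
  have Fi: "F = insert T (F - {T})" using T by blast
  have dis: "disjoint_trees F" using F(1) by (simp add: wf_forest_def)
  have rest: "wf_tree T" "wf_forest (F - {T})" "verts T \<inter> \<Union>(verts ` (F - {T})) = {}"
    using wf_forest_insert[of T "F - {T}"] F(1) Fi by auto
  have T': "wf_tree T'" "verts T' = verts T" "rotates E i j (tree_order T) (tree_order T')"
    using rot_tree_rotates[OF assms(1) T(2) rest(1) elim_order_tree[OF dis F(3,2) T(1)]] by blast+
  let ?Q = "forest_order (F - {T})"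
  have "rotates E i j (tree_order T \<union> ?Q) (tree_order T' \<union> ?Q)"
  proof (rule rotates_Un[OF T'(3) tree_order_subset])
    show "tree_order T' \<subseteq> verts T \<times> verts T" using tree_order_subset[of T'] T'(2) by simp
    show "v \<notin> verts T" if "(u, v) \<in> ?Q" for u v
      using that rest(3) forest_order_subset[of "F - {T}"] by blast
  qed
  then have "rotates E i j (forest_order F) (forest_order F')"
    using Fi T(3) forest_order_insert by metis
  then show rot: "rot_order E V i j (forest_order F) (forest_order F')"
    using rotates_rot_order[OF assms(1) F(3)] by blast
  have "wf_forest F'" unfolding T(3) using wf_forest_insertI[OF T'(1) rest(2)] rest(3) T'(2) by simp
  moreover have "\<Union>(verts ` F') = V" using F(2) Fi T(3) T'(2) by (metis image_insert)
  moreover have "elim_order E V (forest_order F')" using rot by (simp add: rot_order_def)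
  ultimately show "F' \<in> elim_forests E V" using elim_forests_iff[OF assms(1)] by blast
qed

text \<open>Some tree rotation of the edge exists, and \<open>rot_order_unique\<close> identifies
  its order with the given one.\<close>

lemma rot_forest_exists:
  assumes "sym E" "F \<in> elim_forests E V" "rot_order E V i j (forest_order F) R'"
  shows "\<exists>F'. rot_forest E i j F F' \<and> forest_order F' = R'"
proof -
  have wf: "wf_forest F" using assms(2) elim_forests_iff[OF assms(1)] by blast
  have cov: "covers (forest_order F) i j" using rot_order_covers[OF assms(3)] .
  then obtain T where T: "T \<in> F" "(j, i) \<in> tree_order T" unfolding covers_def forest_order_def by blast
  have "covers (tree_order T) i j"
    using cov T unfolding covers_def forest_order_def by blast
  then obtain T' where "rot_tree E i j T T'" using rot_tree_exists wf T(1) unfolding wf_forest_def by blast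
  then have r: "rot_forest E i j F (insert T' (F - {T}))" using T(1) unfolding rot_forest_def by blast
  then show ?thesis using rot_forest_order(2)[OF assms(1,2) r] rot_order_unique[OF assms(3)] by metis
qed

section \<open>Algorithm R\<close>

text \<open>The first entry of the sorted list that lies in \<open>K\<close> is the minimum of
  \<open>K\<close>, so no descendant is smaller than the root.\<close>

lemma ordering_tree:
  assumes "sym E" "finite K" "connected_on E K" "K \<subseteq> set xs" "sorted xs"
  shows "elim_tree E K (ordering_tree E xs K) \<and> decreasing (tree_order (ordering_tree E xs K))"
  using assms(2-5)
proof (induction xs arbitrary: K)
  case Nil
  then show ?case by (simp add: connected_on_def)
next
  case (Cons x xs)
  show ?case
  proof (cases "x \<in> K")
    case False
    then have "K \<subseteq> set xs" using Cons.prems by auto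
    then show ?thesis using False Cons.IH[of K] Cons.prems by simp
  next
    case True
    let ?f = "ordering_tree E xs" and ?P = "components E (K - {x})"
    define C where "C = Abs_fset (?f ` ?P)"
    \<comment> \<open>\<open>Abs_fset\<close> is inverted by \<open>fset\<close> only on finite
      sets, hence the finiteness of the components.\<close>
    have C: "fset C = ?f ` ?P"
      unfolding C_def using finite_components[of "K - {x}"] Cons.prems(1) by (simp add: Abs_fset_inverse)
    have f: "elim_tree E L (?f L) \<and> decreasing (tree_order (?f L))" if L: "L \<in> ?P" for L
    proof (rule Cons.IH)
      show "finite L" using components_subset[OF L] Cons.prems(1) by (meson finite_Diff finite_subset)
      show "connected_on E L" using components_connected[OF assms(1) L] .
      show "L \<subseteq> set xs" using components_subset[OF L] Cons.prems(3) by auto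
      show "sorted xs" using Cons.prems(4) by simp
    qed
    have T: "elim_tree E K (Node x C)"
      by (rule elim_tree.elim_node[of _ _ _ ?f]) (use Cons.prems True f C in auto)
    have "decreasing (tree_order (Node x C))"
      unfolding decreasing_def
    proof clarify
      fix u v assume "(u, v) \<in> tree_order (Node x C)"
      then consider "u \<in> K" "v = x" | "(u, v) \<in> forest_order (fset C)"
        using elim_tree_order[OF assms(1) T] unfolding tree_order_Node by auto
      then show "v \<le> u"
      proof cases
        case 1
        then show ?thesis using Cons.prems(3,4) by auto
      next
        case 2
        then obtain L where "L \<in> ?P" "(u, v) \<in> tree_order (?f L)"
          unfolding C forest_order_def by blast
        then show ?thesis using f unfolding decreasing_def by blast
      qed
    qed
    then show ?thesis using T True by (simp add: C_def)
  qed
qed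

lemma ordering_forest:
  assumes "sym E" "finite V" "V \<subseteq> set xs" "sorted xs"
  shows "ordering_forest E xs V \<in> elim_forests E V" "decreasing (forest_order (ordering_forest E xs V))"
proof -
  have *: "elim_tree E K (ordering_tree E xs K) \<and> decreasing (tree_order (ordering_tree E xs K))"
    if K: "K \<in> components E V" for K
  proof (rule ordering_tree[OF assms(1) _ components_connected[OF assms(1) K] _ assms(4)])
    show "finite K" using components_subset[OF K] assms(2) by (rule finite_subset)
    show "K \<subseteq> set xs" using components_subset[OF K] assms(3) by (rule subset_trans)
  qed
  show "ordering_forest E xs V \<in> elim_forests E V"
    unfolding ordering_forest_def elim_forests_def using * by blast
  show "decreasing (forest_order (ordering_forest E xs V))"
    unfolding ordering_forest_def forest_order_def decreasing_def
    using * unfolding decreasing_def by blast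
qed

text \<open>Injectivity of \<open>forest_order\<close> on elimination forests turns an unvisited
  forest into an unvisited order.\<close>

lemma new_rotation_fresh_move:
  assumes "sym E" "vs \<noteq> []" "set vs \<subseteq> elim_forests E V" "new_rotation E vs j i F"
  shows "F \<in> elim_forests E V" "fresh_move (move E V) (map forest_order vs) j i (forest_order F)"
proof -
  have l: "last vs \<in> elim_forests E V" using assms(2,3) by auto
  have n: "F \<notin> set vs" "i < j" "rot_forest E i j (last vs) F \<or> rot_forest E j i (last vs) F"
    using assms(4) by (auto simp: new_rotation_def up_rotation_def down_rotation_def)
  show F: "F \<in> elim_forests E V" using n(3) rot_forest_order(1)[OF assms(1) l] by blast
  have "forest_order F \<notin> forest_order ` set vs"
    using forest_order_inj[OF assms(1) F] n(1) assms(3) by blast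
  moreover have "move E V j i (forest_order (last vs)) (forest_order F)"
    using n(2,3) rot_forest_order(2)[OF assms(1) l] unfolding move_def by blast
  ultimately show "fresh_move (move E V) (map forest_order vs) j i (forest_order F)"
    using assms(2) by (simp add: fresh_move_def last_map)
qed

lemma fresh_move_new_rotation:
  assumes "sym E" "vs \<noteq> []" "set vs \<subseteq> elim_forests E V"
    "fresh_move (move E V) (map forest_order vs) j i R"
  shows "\<exists>F. new_rotation E vs j i F \<and> forest_order F = R"
proof -
  have l: "last vs \<in> elim_forests E V" using assms(2,3) by auto
  have m: "R \<notin> forest_order ` set vs" "i < j"
    "rot_order E V i j (forest_order (last vs)) R \<or> rot_order E V j i (forest_order (last vs)) R"
    using assms(2,4) by (auto simp: fresh_move_def move_def last_map)
  obtain F where F: "rot_forest E i j (last vs) F \<or> rot_forest E j i (last vs) F" "forest_order F = R"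
    using m(3) rot_forest_exists[OF assms(1) l] by blast
  moreover have "F \<notin> set vs" using m(1) F(2) by blast
  ultimately show ?thesis
    using m(2) unfolding new_rotation_def up_rotation_def down_rotation_def by blast
qed

text \<open>A best move leaves no choice: the largest movable vertex is its label, and every fresh
  rotation of that vertex leads to the order \<open>R\<close>.\<close>

lemma algR_step_best_move:
  assumes "sym E" "vs \<noteq> []" "set vs \<subseteq> elim_forests E V"
    and best: "best_move (move E V) (map forest_order vs) R"
  shows "\<exists>F. algR_step E vs F"
    and "algR_step E vs F \<Longrightarrow> F \<in> elim_forests E V \<and> forest_order F = R"
proof -
  note nf = new_rotation_fresh_move[OF assms(1-3)]
  obtain j i where ji: "fresh_move (move E V) (map forest_order vs) j i R"
    and max: "\<And>j' i' R'. fresh_move (move E V) (map forest_order vs) j' i' R' \<Longrightarrow>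
      j' < j \<or> j' = j \<and> i' = i \<and> R' = R"
    using best unfolding best_move_def by metis
  obtain G where G: "new_rotation E vs j i G"
    using fresh_move_new_rotation[OF assms(1-3) ji] by blast
  have le: "j' \<le> j" if "movable E vs j'" for j'
  proof -
    have "\<exists>i' F'. new_rotation E vs j' i' F'" using that by (simp add: movable_def)
    then obtain i' F' where "new_rotation E vs j' i' F'" by blast
    from max[OF nf(2)[OF this]] show ?thesis by auto
  qed
  have mv: "movable E vs j" using G unfolding movable_def by blast
  have "algR_step E vs G"
    unfolding algR_step_def
  proof (rule exI[of _ j], intro conjI)
    \<comment> \<open>Another \<open>i\<close> would give a competing fresh move with the same
      label, which \<open>max\<close> excludes.\<close>
    show "\<exists>!i. \<exists>F. new_rotation E vs j i F"
      using G max nf(2) by (metis less_irrefl)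
  qed (use mv le G in blast)+
  then show "\<exists>F. algR_step E vs F" ..
  assume "algR_step E vs F"
  then obtain j' i' where j': "movable E vs j'" "\<forall>j''. movable E vs j'' \<longrightarrow> j'' \<le> j'" "new_rotation E vs j' i' F"
    unfolding algR_step_def by blast
  then have "j' = j" using le mv by (meson le_antisym)
  then show "F \<in> elim_forests E V \<and> forest_order F = R"
    using nf[OF j'(3)] max by blast
qed

theorem theorem1:
  fixes n :: nat and E :: "nat rel"
  assumes "simple_graph n E"
    and "chordal E"
    and "perfect_elimination_ordering n E"
  shows "(\<exists>vs. algR_visits E (ordering_forest E [1..<Suc n] {1..n}) vs) \<and>
    (\<forall>vs. algR_visits E (ordering_forest E [1..<Suc n] {1..n}) vs \<longrightarrow>
       distinct vs \<and> set vs = elim_forests E {1..n})"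
proof -
  let ?V = "{1..n}" and ?F0 = "ordering_forest E [1..<Suc n] {1..n}"
  have sym: "sym E" using assms(1) by (simp add: simple_graph_def)
  note iff = elim_forests_iff[OF sym]
  obtain R0 Rs where R0: "elim_order E ?V R0" "decreasing R0" and Rs: "greedy (move E ?V) R0 Rs"
    and all: "set Rs = {R. elim_order E ?V R}"
    using greedy_orders[OF sym assms(3)] by blast
  have F0: "?F0 \<in> elim_forests E ?V" "decreasing (forest_order ?F0)"
    using ordering_forest[OF sym, of ?V "[1..<Suc n]"] by (simp_all add: atLeastLessThanSuc_atLeastAtMost del: upt_Suc)
  \<comment> \<open>Both orders are decreasing, hence equal.\<close>
  have R0_eq: "forest_order ?F0 = R0"
    using decreasing_unique[OF _ R0(1) F0(2) R0(2)] F0(1) iff by blast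
  have len: "1 \<le> length Rs" using greedy_nonempty[OF Rs] by (simp add: Suc_le_eq)
  \<comment> \<open>The run so far spells the first \<open>k\<close> entries of \<open>Rs\<close>,
    by genuine elimination forests.\<close>
  define good where "good k ws \<longleftrightarrow> ws \<noteq> [] \<and> set ws \<subseteq> elim_forests E ?V \<and> 1 \<le> k \<and> k \<le> length Rs \<and>
    map forest_order ws = take k Rs" for k ws
  have good1: "good 1 [?F0]"
    using F0(1) len greedy_take1[OF Rs] R0_eq by (simp add: good_def)
  have progress: "\<exists>F. algR_step E ws F" and extend: "\<And>F. algR_step E ws F \<Longrightarrow> good (Suc k) (ws @ [F])"
    if g: "good k ws" and k: "k < length Rs" for k ws
  proof -
    have ws: "ws \<noteq> []" "set ws \<subseteq> elim_forests E ?V" "map forest_order ws = take k Rs" "1 \<le> k"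
      using g by (auto simp: good_def)
    then have best: "best_move (move E ?V) (map forest_order ws) (Rs ! k)"
      using greedy_nth[OF Rs, of k] k by simp
    show "\<exists>F. algR_step E ws F" using algR_step_best_move(1)[OF sym ws(1,2) best] .
    fix F assume "algR_step E ws F"
    then have "F \<in> elim_forests E ?V" "forest_order F = Rs ! k"
      using algR_step_best_move(2)[OF sym ws(1,2) best] by blast+
    then show "good (Suc k) (ws @ [F])"
      using ws k by (simp add: good_def take_Suc_conv_app_nth)
  qed
  have stop: "set ws = elim_forests E ?V" "distinct ws" "\<not> algR_step E ws F"
    if g: "good (length Rs) ws" for ws F
  proof -
    have ws: "ws \<noteq> []" "set ws \<subseteq> elim_forests E ?V" "map forest_order ws = Rs"
      using g by (auto simp: good_def)
    \<comment> \<open>The order of \<open>G\<close> occurs in \<open>Rs\<close>, hence belongs to a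
      visited forest, which is \<open>G\<close> by injectivity.\<close>
    have "G \<in> set ws" if G: "G \<in> elim_forests E ?V" for G
    proof -
      have "forest_order G \<in> set (map forest_order ws)" using G iff all ws(3) by simp
      then obtain G' where "G' \<in> set ws" "forest_order G = forest_order G'" by auto
      then show ?thesis using forest_order_inj[OF sym G, of G'] ws(2) by auto
    qed
    then show eq: "set ws = elim_forests E ?V" using ws(2) by blast
    show "distinct ws" using greedy_distinct[OF Rs] ws(3) distinct_map by metis
    show "\<not> algR_step E ws F"
    proof
      assume "algR_step E ws F"
      then obtain j i where n: "new_rotation E ws j i F" unfolding algR_step_def by blast
      then show False using new_rotation_fresh_move(1)[OF sym ws(1,2) n] eq
        unfolding new_rotation_def by blast
    qed
  qed
  \<comment> \<open>No run leaves the sequence, and \<open>stop\<close> rules out a step beyond its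
    end.\<close>
  have prefix: "\<exists>k. good k ws" if "algR_reaches E ?F0 ws" for ws
    using that
  proof (induction rule: algR_reaches.induct)
    case start
    then show ?case using good1 by blast
  next
    case (step vs F)
    then obtain k where k: "good k vs" by blast
    then have "k < length Rs \<or> k = length Rs" by (auto simp: good_def)
    then show ?case using stop(3)[of vs F] extend[OF k] \<open>algR_step E vs F\<close> k by blast
  qed
  \<comment> \<open>\<open>Suc k\<close>, because a run starts with one forest already
    visited.\<close>
  have reach: "\<exists>ws. algR_reaches E ?F0 ws \<and> good (Suc k) ws" if "k < length Rs" for k
    using that
  proof (induction k)
    case 0
    show ?case using algR_reaches.start good1 unfolding One_nat_def by blast
  next
    case (Suc k)
    then obtain ws where ws: "algR_reaches E ?F0 ws" "good (Suc k) ws" by auto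
    obtain F where F: "algR_step E ws F" using progress[OF ws(2) Suc.prems] by blast
    then show ?case
      using algR_reaches.step[OF ws(1) F] extend[OF ws(2) Suc.prems F] by blast
  qed
  have "length Rs - 1 < length Rs" "Suc (length Rs - 1) = length Rs" using len by auto
  then obtain ws where "algR_reaches E ?F0 ws" "good (length Rs) ws"
    using reach[of "length Rs - 1"] by metis
  then have "algR_visits E ?F0 ws" using stop(3) by (simp add: algR_visits_def)
  moreover have "distinct vs \<and> set vs = elim_forests E ?V" if vs: "algR_visits E ?F0 vs" for vs
  proof -
    obtain k where k: "good k vs" using prefix vs by (auto simp: algR_visits_def)
    have "\<not> k < length Rs" using progress[OF k] vs by (auto simp: algR_visits_def)
    then have "k = length Rs" using k by (auto simp: good_def)
    then show ?thesis using stop(1,2) k by blast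
  qed
  ultimately show ?thesis by blast
qed

end
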